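(* Let $k$ be a field, let $q,m$ be integers such that $3\le q<m$, and set $n=2m$. Let $T=k[[X_1,\ldots,X_n]]$ be the formal power series ring and let $$F_1=\{X_1,\ldots,X_m\},\quad F_2=\{X_q,X_{q+1},\ldots,X_{m+q-1}\},\quad F_3=\{X_{m+1},\ldots,X_n\}.$$ Let $P_i=(F_i)$ be the prime ideal of $T$ generated by $F_i$, $A=T/(P_1\cap P_2\cap P_3)$, $B=T/P_1\oplus T/P_2\oplus T/P_3$, and $I=A:B$. Then $\operatorname{depth}A=\min\{m-q+1,\,q-1\}+1\ge 3$ and $\operatorname{depth}A/I=1$.
   Context: $A$ is regarded as a subring of $B$ via the diagonal embedding, and $A:B=\{a\in A\mid aB\subseteq A\}$ is the conductor. *)

theory Defs
  imports
    "HOL-Library.Multiset"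
    "HOL-Library.Extended_Nat"
    "HOL-Algebra.Ideal"
    "HOL-Algebra.QuotRing"
    "HOL-Algebra.Chinese_Remainder"
begin

text \<open>
  As in \<^verbatim>\<open>HOL-Algebra.Indexed_Polynomials\<close>, monomials are multisets of variable indices:
  the multiset \<open>\<mu>\<close> stands for \<open>\<Prod>\<^sub>i X\<^sub>i ^ count \<mu> i\<close>, so that multiset sum is the product of
  monomials. A power series in \<open>X\<^sub>1, \<dots>, X\<^sub>n\<close> is an arbitrary family of coefficients that
  vanishes at all monomials involving an index outside \<open>{1..n}\<close>.
\<close>

type_synonym 'k series = "nat multiset \<Rightarrow> 'k"

definition power_series_ring :: "nat \<Rightarrow> ('k::field) series ring" where
  "power_series_ring n =
     \<lparr>carrier = {f. \<forall>\<mu>. f \<mu> \<noteq> 0 \<longrightarrow> set_mset \<mu> \<subseteq> {1..n}},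
      mult = (\<lambda>f g \<mu>. \<Sum>(\<alpha>, \<beta>) | \<alpha> + \<beta> = \<mu>. f \<alpha> * g \<beta>),
      one = (\<lambda>\<mu>. if \<mu> = {#} then 1 else 0),
      zero = (\<lambda>_. 0),
      add = (\<lambda>f g \<mu>. f \<mu> + g \<mu>)\<rparr>"

definition var :: "nat \<Rightarrow> ('k::field) series" where
  "var i = (\<lambda>\<mu>. if \<mu> = {#i#} then 1 else 0)"

lemma finite_antidiagonal_mset: "finite {(\<alpha>, \<beta>). \<alpha> + \<beta> = (\<mu> :: 'a multiset)}"
proof -
  have "finite {\<alpha>. \<alpha> \<subseteq># \<mu>}"
  proof (induction \<mu>)
    case (add x \<mu>)
    have "{\<alpha>. \<alpha> \<subseteq># add_mset x \<mu>} \<subseteq> {\<alpha>. \<alpha> \<subseteq># \<mu>} \<union> add_mset x ` {\<alpha>. \<alpha> \<subseteq># \<mu>}"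
    proof
      fix \<alpha> assume "\<alpha> \<in> {\<alpha>. \<alpha> \<subseteq># add_mset x \<mu>}"
      then have le: "\<alpha> \<subseteq># add_mset x \<mu>" by simp
      show "\<alpha> \<in> {\<alpha>. \<alpha> \<subseteq># \<mu>} \<union> add_mset x ` {\<alpha>. \<alpha> \<subseteq># \<mu>}"
      proof (cases "x \<in># \<alpha>")
        case True
        then obtain \<beta> where "\<alpha> = add_mset x \<beta>" by (metis insert_DiffM)
        with le show ?thesis by auto
      next
        case False
        with le have "\<alpha> \<subseteq># \<mu>"
          by (simp add: subseteq_mset_def) (metis count_eq_zero_iff le0)
        then show ?thesis by simp
      qed
    qed
    then show ?case using add.IH by (meson finite_UnI finite_imageI finite_subset)
  qed simp
  moreover have "{(\<alpha>, \<beta>). \<alpha> + \<beta> = \<mu>} \<subseteq> (\<lambda>\<alpha>. (\<alpha>, \<mu> - \<alpha>)) ` {\<alpha>. \<alpha> \<subseteq># \<mu>}"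
    by auto
  ultimately show ?thesis using finite_surj by blast
qed

lemma power_series_mult_assoc:
  fixes f g h :: "('k::field) series"
  shows "(\<Sum>(\<alpha>, \<gamma>) | \<alpha> + \<gamma> = \<mu>. (\<Sum>(\<beta>, \<delta>) | \<beta> + \<delta> = \<alpha>. f \<beta> * g \<delta>) * h \<gamma>) =
         (\<Sum>(\<alpha>, \<gamma>) | \<alpha> + \<gamma> = \<mu>. f \<alpha> * (\<Sum>(\<beta>, \<delta>) | \<beta> + \<delta> = \<gamma>. g \<beta> * h \<delta>))"
proof -
  let ?D = "\<lambda>\<mu>. {(\<alpha>, \<beta>). \<alpha> + \<beta> = (\<mu> :: nat multiset)}"
  have "(\<Sum>(\<alpha>, \<gamma>) \<in> ?D \<mu>. (\<Sum>(\<beta>, \<delta>) \<in> ?D \<alpha>. f \<beta> * g \<delta>) * h \<gamma>) =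
        (\<Sum>p \<in> ?D \<mu>. \<Sum>r \<in> ?D (fst p). f (fst r) * g (snd r) * h (snd p))"
    by (simp add: sum_distrib_right case_prod_beta)
  also have "\<dots> = (\<Sum>(p, r) \<in> Sigma (?D \<mu>) (\<lambda>p. ?D (fst p)). f (fst r) * g (snd r) * h (snd p))"
    by (rule sum.Sigma) (auto intro: finite_antidiagonal_mset)
  also have "\<dots> = (\<Sum>(p, r) \<in> Sigma (?D \<mu>) (\<lambda>p. ?D (snd p)). f (fst p) * (g (fst r) * h (snd r)))"
    by (rule sum.reindex_bij_witness
          [where i = "\<lambda>((a, c), (b, d)). ((a + b, d), (a, b))"
             and j = "\<lambda>((a, c), (b, d)). ((b, d + c), (d, c))"])
       (auto simp: algebra_simps)
  also have "\<dots> = (\<Sum>p \<in> ?D \<mu>. \<Sum>r \<in> ?D (snd p). f (fst p) * (g (fst r) * h (snd r)))"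
    by (rule sum.Sigma [symmetric]) (auto intro: finite_antidiagonal_mset)
  also have "\<dots> = (\<Sum>(\<alpha>, \<gamma>) \<in> ?D \<mu>. f \<alpha> * (\<Sum>(\<beta>, \<delta>) \<in> ?D \<gamma>. g \<beta> * h \<delta>))"
    by (simp add: sum_distrib_left case_prod_beta)
  finally show ?thesis by simp
qed

lemma power_series_mult_comm:
  fixes f g :: "('k::field) series"
  shows "(\<Sum>(\<alpha>, \<beta>) | \<alpha> + \<beta> = \<mu>. f \<alpha> * g \<beta>) = (\<Sum>(\<alpha>, \<beta>) | \<alpha> + \<beta> = \<mu>. g \<alpha> * f \<beta>)"
  by (rule sum.reindex_bij_witness [where i = prod.swap and j = prod.swap])
     (auto simp: algebra_simps)

lemma power_series_one_mult:
  fixes f :: "('k::field) series"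
  shows "(\<Sum>(\<alpha>, \<beta>) | \<alpha> + \<beta> = \<mu>. (if \<alpha> = {#} then 1 else 0) * f \<beta>) = f \<mu>"
proof -
  have "(\<Sum>(\<alpha>, \<beta>) | \<alpha> + \<beta> = \<mu>. (if \<alpha> = {#} then 1 else 0) * f \<beta>) =
        (\<Sum>(\<alpha>, \<beta>) \<in> {({#} :: nat multiset, \<mu>)}. (if \<alpha> = {#} then 1 else 0) * f \<beta>)"
    by (rule sum.mono_neutral_right) (auto intro: finite_antidiagonal_mset split: if_splits)
  then show ?thesis by simp
qed

lemma power_series_mult_closed:
  fixes f g :: "('k::field) series"
  assumes "f \<in> carrier (power_series_ring n)" "g \<in> carrier (power_series_ring n)"
  shows "f \<otimes>\<^bsub>power_series_ring n\<^esub> g \<in> carrier (power_series_ring n)"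
proof -
  have "set_mset \<mu> \<subseteq> {1..n}" if "(\<Sum>(\<alpha>, \<beta>) | \<alpha> + \<beta> = \<mu>. f \<alpha> * g \<beta>) \<noteq> 0" for \<mu>
  proof -
    from that obtain p where "p \<in> {(\<alpha>, \<beta>). \<alpha> + \<beta> = \<mu>}" "(case p of (\<alpha>, \<beta>) \<Rightarrow> f \<alpha> * g \<beta>) \<noteq> 0"
      by (metis (no_types, lifting) sum.neutral)
    then obtain \<alpha> \<beta> where "\<mu> = \<alpha> + \<beta>" "f \<alpha> \<noteq> 0" "g \<beta> \<noteq> 0" by auto
    with assms show ?thesis by (auto simp: power_series_ring_def)
  qed
  then show ?thesis by (simp add: power_series_ring_def)
qed

lemma cring_power_series_ring: "cring (power_series_ring n :: ('k::field) series ring)"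
proof (rule cringI)
  show "abelian_group (power_series_ring n :: 'k series ring)"
  proof (rule abelian_groupI)
    fix x y :: "'k series"
    assume x: "x \<in> carrier (power_series_ring n)"
    show "\<exists>y\<in>carrier (power_series_ring n). y \<oplus>\<^bsub>power_series_ring n\<^esub> x = \<zero>\<^bsub>power_series_ring n\<^esub>"
      by (rule bexI [of _ "\<lambda>\<mu>. - x \<mu>"]) (use x in \<open>auto simp: power_series_ring_def\<close>)
    assume y: "y \<in> carrier (power_series_ring n)"
    show "x \<oplus>\<^bsub>power_series_ring n\<^esub> y \<in> carrier (power_series_ring n)"
      using x y by (simp add: power_series_ring_def) (metis add_0)
  qed (auto simp: power_series_ring_def algebra_simps)
  show "comm_monoid (power_series_ring n :: 'k series ring)"
  proof (rule comm_monoidI)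
    fix x y z :: "'k series"
    show "x \<otimes>\<^bsub>power_series_ring n\<^esub> y = y \<otimes>\<^bsub>power_series_ring n\<^esub> x"
      using power_series_mult_comm [of x y] by (auto simp: power_series_ring_def)
    show "x \<otimes>\<^bsub>power_series_ring n\<^esub> y \<otimes>\<^bsub>power_series_ring n\<^esub> z =
          x \<otimes>\<^bsub>power_series_ring n\<^esub> (y \<otimes>\<^bsub>power_series_ring n\<^esub> z)"
      using power_series_mult_assoc [of x y z] by (auto simp: power_series_ring_def)
    show "\<one>\<^bsub>power_series_ring n\<^esub> \<otimes>\<^bsub>power_series_ring n\<^esub> x = x"
      using power_series_one_mult [of x] by (auto simp: power_series_ring_def)
    show "\<one>\<^bsub>power_series_ring n\<^esub> \<in> (carrier (power_series_ring n) :: 'k series set)"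
      by (auto simp: power_series_ring_def)
  qed (rule power_series_mult_closed)
  fix x y z :: "'k series"
  show "(x \<oplus>\<^bsub>power_series_ring n\<^esub> y) \<otimes>\<^bsub>power_series_ring n\<^esub> z =
        x \<otimes>\<^bsub>power_series_ring n\<^esub> z \<oplus>\<^bsub>power_series_ring n\<^esub> y \<otimes>\<^bsub>power_series_ring n\<^esub> z"
    by (auto simp: power_series_ring_def case_prod_beta algebra_simps sum.distrib)
qed

lemma var_in_carrier: "i \<in> {1..n} \<Longrightarrow> var i \<in> carrier (power_series_ring n)"
  by (auto simp: power_series_ring_def var_def)

text \<open>
  The second conjunct says that \<open>xs ! i\<close> is a non-zero-divisor on the quotient of \<open>R\<close> by the ideal
  generated by the preceding elements, the third that the quotient by the whole sequence is
  nonzero.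
\<close>

definition regular_sequence :: "('a, 'b) ring_scheme \<Rightarrow> 'a list \<Rightarrow> bool" where
  "regular_sequence R xs \<longleftrightarrow>
     set xs \<subseteq> carrier R \<and>
     (\<forall>i < length xs. \<forall>a \<in> carrier R.
        (xs ! i) \<otimes>\<^bsub>R\<^esub> a \<in> Idl\<^bsub>R\<^esub> (set (take i xs)) \<longrightarrow> a \<in> Idl\<^bsub>R\<^esub> (set (take i xs))) \<and>
     Idl\<^bsub>R\<^esub> (set xs) \<noteq> carrier R"

text \<open>Meaningful only if \<open>R\<close> is local, i.e. has exactly one maximal ideal.\<close>

definition the_maximal_ideal :: "('a, 'b) ring_scheme \<Rightarrow> 'a set" where
  "the_maximal_ideal R = (THE M. maximalideal M R)"

definition depth :: "('a, 'b) ring_scheme \<Rightarrow> enat" where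
  "depth R = (SUP xs \<in> {xs. set xs \<subseteq> the_maximal_ideal R \<and> regular_sequence R xs}. enat (length xs))"

text \<open>
  \<open>A : B\<close>, where \<open>A\<close> is regarded as a subring of \<open>B\<close> via the embedding \<open>\<phi>\<close>; the conductor is
  returned as a subset of \<open>A\<close> itself.
\<close>

definition conductor ::
    "('a, 'c) ring_scheme \<Rightarrow> ('a \<Rightarrow> 'b) \<Rightarrow> ('b, 'd) ring_scheme \<Rightarrow> 'a set" where
  "conductor A \<phi> B =
     {a \<in> carrier A. \<forall>b \<in> carrier B. \<phi> a \<otimes>\<^bsub>B\<^esub> b \<in> \<phi> ` carrier A}"

text \<open>
  The diagonal map \<open>T/P \<rightarrow> T/P\<^sub>1 \<times> T/P\<^sub>2 \<times> T/P\<^sub>3\<close> for ideals \<open>P \<subseteq> P\<^sub>1 \<inter> P\<^sub>2 \<inter> P\<^sub>3\<close>. Elements of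
  \<open>T/P\<close> are cosets \<open>C\<close> of \<open>P\<close>, and the unique coset of \<open>P\<^sub>i\<close> containing \<open>C\<close> is the set sum
  \<open>P\<^sub>i + C\<close>; see lemma \<open>diagonal_coset\<close> below.
\<close>

definition diagonal ::
    "('a, 'b) ring_scheme \<Rightarrow> 'a set \<Rightarrow> 'a set \<Rightarrow> 'a set \<Rightarrow> 'a set \<Rightarrow> 'a set \<times> 'a set \<times> 'a set" where
  "diagonal T P\<^sub>1 P\<^sub>2 P\<^sub>3 C = (P\<^sub>1 <+>\<^bsub>T\<^esub> C, P\<^sub>2 <+>\<^bsub>T\<^esub> C, P\<^sub>3 <+>\<^bsub>T\<^esub> C)"

lemma set_add_coset:
  assumes "ideal P T" "ideal Q T" "P \<subseteq> Q" "t \<in> carrier T"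
  shows "Q <+>\<^bsub>T\<^esub> (P +>\<^bsub>T\<^esub> t) = Q +>\<^bsub>T\<^esub> t"
proof -
  interpret P: ideal P T by fact
  interpret Q: ideal Q T by fact
  have "Q <+>\<^bsub>T\<^esub> P = Q"
  proof (intro equalityI subsetI)
    fix x assume "x \<in> Q <+>\<^bsub>T\<^esub> P"
    then show "x \<in> Q" using assms(3) by (auto simp: set_add_def')
  next
    fix x assume x: "x \<in> Q"
    then have "x = x \<oplus>\<^bsub>T\<^esub> \<zero>\<^bsub>T\<^esub>" by (simp add: Q.Icarr)
    then show "x \<in> Q <+>\<^bsub>T\<^esub> P" using x additive_subgroup.zero_closed [OF P.is_additive_subgroup]
      unfolding set_add_def' by blast
  qed
  moreover have "Q <+>\<^bsub>T\<^esub> (P +>\<^bsub>T\<^esub> t) = (Q <+>\<^bsub>T\<^esub> P) +>\<^bsub>T\<^esub> t"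
    using assms(4) P.a_subset Q.a_subset by (simp add: P.a_setmult_rcos_assoc)
  ultimately show ?thesis by simp
qed

lemma diagonal_coset:
  assumes "ideal P T" "ideal P\<^sub>1 T" "ideal P\<^sub>2 T" "ideal P\<^sub>3 T" "P \<subseteq> P\<^sub>1 \<inter> P\<^sub>2 \<inter> P\<^sub>3"
    and "t \<in> carrier T"
  shows "diagonal T P\<^sub>1 P\<^sub>2 P\<^sub>3 (P +>\<^bsub>T\<^esub> t) = (P\<^sub>1 +>\<^bsub>T\<^esub> t, P\<^sub>2 +>\<^bsub>T\<^esub> t, P\<^sub>3 +>\<^bsub>T\<^esub> t)"
  using assms by (simp add: diagonal_def set_add_coset)

end

theory Submission
  imports Defs
begin

text \<open>
  Upper bounds on the depth come from the Koszul complex on \<open>X\<^sub>1, \<dots>, X\<^sub>n\<close>: a regular sequence of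
  length \<open>e\<close> in the maximal ideal kills its homology on \<open>T/J\<close> in all degrees above \<open>n - e\<close>. If
  \<open>W = U \<union> V\<close> is a disjoint union with \<open>X\<^sub>u X\<^sub>v \<in> J\<close> for \<open>u \<in> U\<close>, \<open>v \<in> V\<close>, there is an explicit
  nonzero class in degree \<open>|W| - 1\<close>, so \<open>e \<le> n - |W| + 1\<close>. For \<open>A\<close> the sets \<open>F\<^sub>1 \<union> F\<^sub>2\<close> and
  \<open>F\<^sub>2 \<union> F\<^sub>3\<close> give the two terms of the minimum; for \<open>A/I = T/((P\<^sub>1 + P\<^sub>2) \<inter> (P\<^sub>2 + P\<^sub>3))\<close> one takes
  all variables.

  The lower bound for \<open>A\<close> is attained by the elements \<open>X\<^sub>i + X\<^sub>m\<^sub>+\<^sub>q\<^sub>-\<^sub>1\<^sub>+\<^sub>i\<close> for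
  \<open>1 \<le> i \<le> min (m - q + 1) (q - 1)\<close>, followed by \<open>X\<^sub>1 + X\<^sub>q + X\<^sub>m\<^sub>+\<^sub>1\<close>. They are regular on each
  \<open>T/P\<^sub>i\<close>, and all but the last are regular on \<open>T/(P\<^sub>1 + P\<^sub>2)\<close> and \<open>T/(P\<^sub>2 + P\<^sub>3)\<close>, which allows gluing
  since \<open>P\<^sub>1 + (P\<^sub>2 \<inter> P\<^sub>3) = P\<^sub>1 + P\<^sub>2\<close>.
\<close>

section \<open>Regular sequences modulo ideals\<close>

text \<open>Ideals in a type of class \<open>comm_ring_1\<close> need no carrier set; the locale
  \<open>ps_quotient\<close> passes to ideals of ring records.\<close>

definition is_ideal :: "'a::comm_ring_1 set \<Rightarrow> bool" where
  "is_ideal J \<longleftrightarrow> 0 \<in> J \<and> (\<forall>a\<in>J. \<forall>b\<in>J. a + b \<in> J) \<and> (\<forall>r. \<forall>a\<in>J. r * a \<in> J)"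

definition ideal_sum :: "'a::comm_ring_1 set \<Rightarrow> 'a set \<Rightarrow> 'a set" where
  "ideal_sum I J = {a + b | a b. a \<in> I \<and> b \<in> J}"

definition adjoin :: "'a::comm_ring_1 set \<Rightarrow> 'a \<Rightarrow> 'a set" where
  "adjoin J z = {a + b * z | a b. a \<in> J}"

definition regular_mod :: "'a::comm_ring_1 set \<Rightarrow> 'a \<Rightarrow> bool" where
  "regular_mod J z \<longleftrightarrow> (\<forall>a. z * a \<in> J \<longrightarrow> a \<in> J)"

text \<open>The ideal grows along the recursion, so inductions on the list generalise over
  \<open>J\<close>; \<open>foldl adjoin J zs\<close> is J + (zs). That the last quotient is nonzero
  is dealt with in \<open>regular_sequence_iff\<close>.\<close>

primrec regular_seq_mod :: "'a::comm_ring_1 set \<Rightarrow> 'a list \<Rightarrow> bool" where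
  "regular_seq_mod J [] \<longleftrightarrow> True"
| "regular_seq_mod J (z # zs) \<longleftrightarrow> regular_mod J z \<and> regular_seq_mod (adjoin J z) zs"

lemma is_idealI:
  assumes "0 \<in> J" "\<And>a b. a \<in> J \<Longrightarrow> b \<in> J \<Longrightarrow> a + b \<in> J" "\<And>r a. a \<in> J \<Longrightarrow> r * a \<in> J"
  shows "is_ideal J"
  using assms by (simp add: is_ideal_def)

context
  fixes J :: "'a::comm_ring_1 set"
  assumes J: "is_ideal J"
begin

lemma is_ideal_zero: "0 \<in> J"
  using J by (simp add: is_ideal_def)

lemma is_ideal_add: "a \<in> J \<Longrightarrow> b \<in> J \<Longrightarrow> a + b \<in> J"
  using J by (simp add: is_ideal_def)

lemma is_ideal_mult: "a \<in> J \<Longrightarrow> r * a \<in> J"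
  using J by (simp add: is_ideal_def)

lemma is_ideal_mult_right: "a \<in> J \<Longrightarrow> a * r \<in> J"
  using is_ideal_mult [of a r] by (simp add: mult.commute)

lemma is_ideal_uminus: "a \<in> J \<Longrightarrow> - a \<in> J"
  using is_ideal_mult [of a "- 1"] by simp

lemma is_ideal_diff: "a \<in> J \<Longrightarrow> b \<in> J \<Longrightarrow> a - b \<in> J"
  using is_ideal_add [of a "- b"] is_ideal_uminus by simp

lemma is_ideal_sum: "(\<And>i. i \<in> S \<Longrightarrow> f i \<in> J) \<Longrightarrow> sum f S \<in> J"
  by (induction S rule: infinite_finite_induct) (auto intro: is_ideal_zero is_ideal_add)

lemma is_ideal_cong: "a - b \<in> J \<Longrightarrow> a \<in> J \<longleftrightarrow> b \<in> J"
  using is_ideal_add [of "a - b" b] is_ideal_diff [of a "a - b"] by auto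

lemma adjoin_supset: "J \<subseteq> adjoin J z"
proof
  fix a assume "a \<in> J"
  then have "a + 0 * z \<in> adjoin J z" unfolding adjoin_def by blast
  then show "a \<in> adjoin J z" by simp
qed

lemma self_in_adjoin: "z \<in> adjoin J z"
proof -
  have "0 + 1 * z \<in> adjoin J z" unfolding adjoin_def using is_ideal_zero by blast
  then show ?thesis by simp
qed

lemma is_ideal_adjoin: "is_ideal (adjoin J z)"
proof (rule is_idealI)
  show "0 \<in> adjoin J z" using adjoin_supset is_ideal_zero by blast
next
  fix a b assume "a \<in> adjoin J z" "b \<in> adjoin J z"
  then obtain a1 a2 b1 b2 where *: "a = a1 + a2 * z" "b = b1 + b2 * z" "a1 \<in> J" "b1 \<in> J"
    unfolding adjoin_def by blast
  then have "a + b = (a1 + b1) + (a2 + b2) * z" by (simp add: algebra_simps)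
  then show "a + b \<in> adjoin J z" unfolding adjoin_def using * is_ideal_add by blast
next
  fix r a assume "a \<in> adjoin J z"
  then obtain a1 a2 where *: "a = a1 + a2 * z" "a1 \<in> J" unfolding adjoin_def by blast
  then have "r * a = r * a1 + (r * a2) * z" by (simp add: algebra_simps)
  then show "r * a \<in> adjoin J z" unfolding adjoin_def using * is_ideal_mult by blast
qed

lemma adjoin_minimal:
  assumes "is_ideal K" "J \<subseteq> K" "z \<in> K"
  shows "adjoin J z \<subseteq> K"
  using assms unfolding adjoin_def is_ideal_def by blast

lemma adjoin_cong:
  assumes "z - z' \<in> J"
  shows "adjoin J z = adjoin J z'"
proof -
  have "a + b * z \<in> adjoin J z'" if "a \<in> J" for a b
  proof -
    have "a + b * z = (a + b * (z - z')) + b * z'" by (simp add: algebra_simps)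
    then show ?thesis unfolding adjoin_def using that assms is_ideal_add is_ideal_mult by blast
  qed
  moreover have "a + b * z' \<in> adjoin J z" if "a \<in> J" for a b
  proof -
    have "a + b * z' = (a - b * (z - z')) + b * z" by (simp add: algebra_simps)
    then show ?thesis unfolding adjoin_def using that assms is_ideal_diff is_ideal_mult by blast
  qed
  ultimately show ?thesis unfolding adjoin_def by blast
qed

lemma regular_mod_cong:
  assumes "z - z' \<in> J"
  shows "regular_mod J z \<longleftrightarrow> regular_mod J z'"
proof -
  have "z * a \<in> J \<longleftrightarrow> z' * a \<in> J" for a
    using is_ideal_cong [of "z * a" "z' * a"] is_ideal_mult_right [OF assms, of a]
    by (simp add: algebra_simps)
  then show ?thesis by (simp add: regular_mod_def)
qed

end

lemma is_ideal_Int: "is_ideal I \<Longrightarrow> is_ideal J \<Longrightarrow> is_ideal (I \<inter> J)"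
  by (auto simp: is_ideal_def)

lemma is_ideal_foldl_adjoin: "is_ideal J \<Longrightarrow> is_ideal (foldl adjoin J zs)"
  by (induction zs arbitrary: J) (auto intro: is_ideal_adjoin)

lemma foldl_adjoin_supset: "is_ideal J \<Longrightarrow> J \<subseteq> foldl adjoin J zs"
  by (induction zs arbitrary: J) (auto dest: is_ideal_adjoin adjoin_supset)

lemma set_subset_foldl_adjoin: "is_ideal J \<Longrightarrow> set zs \<subseteq> foldl adjoin J zs"
proof (induction zs arbitrary: J)
  case (Cons z zs)
  have "z \<in> foldl adjoin (adjoin J z) zs"
    using foldl_adjoin_supset [OF is_ideal_adjoin [OF Cons.prems]] self_in_adjoin [OF Cons.prems]
    by blast
  then show ?case using Cons.IH [OF is_ideal_adjoin [OF Cons.prems]] by simp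
qed simp

lemma foldl_adjoin_minimal:
  assumes "is_ideal J" "is_ideal K" "J \<subseteq> K" "set zs \<subseteq> K"
  shows "foldl adjoin J zs \<subseteq> K"
  using assms(1,3,4)
proof (induction zs arbitrary: J)
  case (Cons z zs)
  then have "foldl adjoin (adjoin J z) zs \<subseteq> K"
    using adjoin_minimal [OF _ assms(2)] is_ideal_adjoin by (intro Cons.IH) auto
  then show ?case by simp
qed simp

lemma regular_seq_mod_append:
  "regular_seq_mod J (zs @ ws) \<longleftrightarrow>
     regular_seq_mod J zs \<and> regular_seq_mod (foldl adjoin J zs) ws"
  by (induction zs arbitrary: J) auto

lemma regular_seq_mod_nth:
  "regular_seq_mod J zs \<longleftrightarrow>
     (\<forall>i < length zs. regular_mod (foldl adjoin J (take i zs)) (zs ! i))"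
proof (induction zs arbitrary: J)
  case (Cons z zs)
  show ?case by (auto simp: Cons.IH less_Suc_eq_0_disj)
qed simp

text \<open>If f = i + a z = j + b z, then z (a - b) lies in I + J, hence so does a - b by
  regularity. Splitting a - b = i' + j' gives one coefficient c = a - i' = b + j' of z that serves
  for both ideals.\<close>

lemma adjoin_Int:
  assumes I: "is_ideal I" and J: "is_ideal J" and reg: "regular_mod (ideal_sum I J) z"
  shows "adjoin (I \<inter> J) z = adjoin I z \<inter> adjoin J z"
proof (intro equalityI subsetI)
  fix f assume "f \<in> adjoin I z \<inter> adjoin J z"
  then obtain i a j b where f: "f = i + a * z" "f = j + b * z" and "i \<in> I" "j \<in> J"
    unfolding adjoin_def by blast
  have "z * (a - b) = (- i) + j" using f by (simp add: algebra_simps)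
  then have "z * (a - b) \<in> ideal_sum I J"
    unfolding ideal_sum_def using is_ideal_uminus [OF I \<open>i \<in> I\<close>] \<open>j \<in> J\<close> by blast
  then have "a - b \<in> ideal_sum I J" using reg by (simp add: regular_mod_def)
  then obtain i' j' where ij: "a - b = i' + j'" "i' \<in> I" "j' \<in> J" unfolding ideal_sum_def by blast
  define c where "c = a - i'"
  have c: "c = b + j'" using ij by (simp add: c_def algebra_simps)
  have "f - c * z = i + i' * z" using f(1) by (simp add: c_def algebra_simps)
  then have "f - c * z \<in> I" using I ij \<open>i \<in> I\<close> by (simp add: is_ideal_add is_ideal_mult_right)
  moreover have "f - c * z = j - j' * z" using f(2) by (simp add: c algebra_simps)
  then have "f - c * z \<in> J" using J ij \<open>j \<in> J\<close> by (simp add: is_ideal_diff is_ideal_mult_right)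
  moreover have "f = (f - c * z) + c * z" by simp
  ultimately show "f \<in> adjoin (I \<inter> J) z" unfolding adjoin_def by blast
qed (auto simp: adjoin_def)

lemma ideal_sum_adjoin: "ideal_sum (adjoin I z) (adjoin J z) = adjoin (ideal_sum I J) z"
proof (intro equalityI subsetI)
  fix f assume "f \<in> ideal_sum (adjoin I z) (adjoin J z)"
  then obtain i a j b where "f = (i + a * z) + (j + b * z)" "i \<in> I" "j \<in> J"
    unfolding adjoin_def ideal_sum_def by blast
  moreover from this have "f = (i + j) + (a + b) * z" by (simp add: algebra_simps)
  ultimately show "f \<in> adjoin (ideal_sum I J) z" unfolding adjoin_def ideal_sum_def by blast
next
  fix f assume "f \<in> adjoin (ideal_sum I J) z"
  then obtain i j a where "f = (i + j) + a * z" "i \<in> I" "j \<in> J"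
    unfolding adjoin_def ideal_sum_def by blast
  moreover from this have "f = (i + a * z) + (j + 0 * z)" by (simp add: algebra_simps)
  ultimately show "f \<in> ideal_sum (adjoin I z) (adjoin J z)"
    unfolding adjoin_def ideal_sum_def by blast
qed

lemma regular_mod_Int: "regular_mod I z \<Longrightarrow> regular_mod J z \<Longrightarrow> regular_mod (I \<inter> J) z"
  by (auto simp: regular_mod_def)

text \<open>
  An elementwise version of the depth lemma for
  \<open>0 \<rightarrow> R/(I \<inter> J) \<rightarrow> R/I \<oplus> R/J \<rightarrow> R/(I + J) \<rightarrow> 0\<close>.
\<close>

lemma regular_seq_mod_Int:
  assumes "is_ideal I" "is_ideal J" "regular_seq_mod (ideal_sum I J) zs"
    and "regular_seq_mod I (zs @ [w])" "regular_seq_mod J (zs @ [w])"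
  shows "regular_seq_mod (I \<inter> J) (zs @ [w])"
  using assms
proof (induction zs arbitrary: I J)
  case Nil
  then show ?case by (simp add: regular_mod_Int)
next
  case (Cons z zs)
  have "regular_seq_mod (adjoin I z \<inter> adjoin J z) (zs @ [w])"
    using Cons.prems by (intro Cons.IH is_ideal_adjoin) (auto simp: ideal_sum_adjoin)
  then show ?case using Cons.prems by (simp add: adjoin_Int regular_mod_Int)
qed

section \<open>The Koszul complex\<close>

text \<open>
  Koszul chains on the elements \<open>X j\<close>, \<open>j \<in> N\<close>, are functions on the subsets of \<open>N\<close>; the degree
  of \<open>S\<close> is its cardinality.
\<close>

definition koszul_sign :: "nat \<Rightarrow> nat set \<Rightarrow> 'a::comm_ring_1" where
  "koszul_sign j S = (- 1) ^ card {i \<in> S. i < j}"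

text \<open>Coefficient at e_S of the Koszul differential: e_S arises by removing one index j from
  \<open>insert j S\<close>.\<close>

definition koszul :: "nat set \<Rightarrow> (nat \<Rightarrow> 'a::comm_ring_1) \<Rightarrow> (nat set \<Rightarrow> 'a) \<Rightarrow> nat set \<Rightarrow> 'a" where
  "koszul N X w S = (\<Sum>j \<in> N - S. koszul_sign j S * X j * w (insert j S))"

text \<open>Exterior multiplication by e_j, on coefficients.\<close>

definition koszul_homotopy :: "nat \<Rightarrow> (nat set \<Rightarrow> 'a::comm_ring_1) \<Rightarrow> nat set \<Rightarrow> 'a" where
  "koszul_homotopy j w S = (if j \<in> S then koszul_sign j (S - {j}) * w (S - {j}) else 0)"

text \<open>Exactness in degree i with coefficients in R/J, written with representatives in R. For
  finite \<open>N\<close> only the values of \<open>w\<close> in degree i and of \<open>v\<close> in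
  degree i + 1 enter.\<close>

definition koszul_exact :: "nat set \<Rightarrow> (nat \<Rightarrow> 'a::comm_ring_1) \<Rightarrow> 'a set \<Rightarrow> nat \<Rightarrow> bool" where
  "koszul_exact N X J i \<longleftrightarrow>
     (\<forall>w. (\<forall>S \<subseteq> N. Suc (card S) = i \<longrightarrow> koszul N X w S \<in> J) \<longrightarrow>
       (\<exists>v. \<forall>S \<subseteq> N. card S = i \<longrightarrow> w S - koszul N X v S \<in> J))"

lemma koszul_exactD:
  assumes "koszul_exact N X J i" "\<forall>S\<subseteq>N. Suc (card S) = i \<longrightarrow> koszul N X w S \<in> J"
  shows "\<exists>v. \<forall>S\<subseteq>N. card S = i \<longrightarrow> w S - koszul N X v S \<in> J"
  using assms by (simp add: koszul_exact_def)

section \<open>Sign rules and identities of the Koszul complex\<close>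

lemma koszul_sign_square [simp]: "koszul_sign j S * koszul_sign j S = 1"
  by (simp add: koszul_sign_def flip: power_mult_distrib)

lemma koszul_sign_insert:
  assumes "finite S" "i \<notin> S"
  shows "koszul_sign j (insert i S) = (if i < j then - koszul_sign j S else koszul_sign j S)"
proof -
  have "{k \<in> insert i S. k < j} = (if i < j then insert i {k \<in> S. k < j} else {k \<in> S. k < j})"
    by auto
  then show ?thesis using assms by (simp add: koszul_sign_def)
qed

lemma koszul_sign_anticomm:
  assumes "finite S" "i \<notin> S" "j \<notin> S" "i \<noteq> j"
  shows "koszul_sign j S * koszul_sign i (insert j S) =
         - (koszul_sign i S * koszul_sign j (insert i S))"
  using assms by (auto simp: koszul_sign_insert mult.commute)

lemma koszul_sign_anticomm':
  assumes "finite S" "i \<notin> S" "j \<notin> S" "i \<noteq> j"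
  shows "koszul_sign i (insert j S) * koszul_sign j (insert i S) =
         - (koszul_sign i S * koszul_sign j S)"
  using assms by (auto simp: koszul_sign_insert)

text \<open>Each term with j < i is paired with its mirror image. That the sum equals its own
  negative would not suffice in characteristic 2.\<close>

lemma sum_antisymmetric:
  fixes g :: "nat \<Rightarrow> nat \<Rightarrow> 'a::comm_ring_1"
  assumes "finite A" "\<And>i j. i \<in> A \<Longrightarrow> j \<in> A \<Longrightarrow> i \<noteq> j \<Longrightarrow> g i j = - g j i"
  shows "(\<Sum>i\<in>A. \<Sum>j\<in>A - {i}. g i j) = 0"
proof -
  have "(\<Sum>i\<in>A. \<Sum>j\<in>A - {i}. g i j) =
        (\<Sum>i\<in>A. (\<Sum>j\<in>A. if j < i then g i j else 0) + (\<Sum>j\<in>A. if i < j then g i j else 0))"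
  proof (rule sum.cong [OF refl])
    fix i assume "i \<in> A"
    have "(\<Sum>j\<in>A - {i}. g i j) = (\<Sum>j\<in>A. if j = i then 0 else g i j)"
      using assms(1) by (intro sum.mono_neutral_cong_left) auto
    also have "\<dots> = (\<Sum>j\<in>A. (if j < i then g i j else 0) + (if i < j then g i j else 0))"
      by (rule sum.cong) auto
    finally show "(\<Sum>j\<in>A - {i}. g i j) =
        (\<Sum>j\<in>A. if j < i then g i j else 0) + (\<Sum>j\<in>A. if i < j then g i j else 0)"
      by (simp add: sum.distrib)
  qed
  also have "\<dots> = (\<Sum>i\<in>A. \<Sum>j\<in>A. if j < i then g i j else 0) +
                 (\<Sum>j\<in>A. \<Sum>i\<in>A. if i < j then g i j else 0)"
    using sum.swap [of "\<lambda>i j. if i < j then g i j else 0" A A] by (simp add: sum.distrib)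
  also have "\<dots> = (\<Sum>i\<in>A. \<Sum>j\<in>A. (if j < i then g i j else 0) + (if j < i then g j i else 0))"
    by (simp add: sum.distrib)
  also have "\<dots> = 0"
  proof (intro sum.neutral ballI)
    fix i j assume "i \<in> A" "j \<in> A"
    then have "j < i \<Longrightarrow> g i j + g j i = 0"
      using assms(2) [of i j] by (metis add.left_inverse less_irrefl)
    then show "(if j < i then g i j else 0) + (if j < i then g j i else 0) = 0" by simp
  qed
  finally show ?thesis .
qed

lemma koszul_square:
  assumes "finite N" "finite S"
  shows "koszul N X (koszul N X w) S = 0"
proof -
  have "koszul N X (koszul N X w) S =
    (\<Sum>i\<in>N - S. \<Sum>j\<in>(N - S) - {i}. koszul_sign i S * X i *
        (koszul_sign j (insert i S) * X j * w (insert j (insert i S))))"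
    unfolding koszul_def by (simp add: sum_distrib_left Diff_insert [symmetric] insert_commute)
  also have "\<dots> = 0"
  proof (rule sum_antisymmetric)
    fix i j assume *: "i \<in> N - S" "j \<in> N - S" "i \<noteq> j"
    have "koszul_sign i S * X i * (koszul_sign j (insert i S) * X j * w (insert j (insert i S))) =
          (koszul_sign i S * koszul_sign j (insert i S)) * (X i * X j * w (insert i (insert j S)))"
      by (simp add: algebra_simps insert_commute)
    also have "koszul_sign i S * koszul_sign j (insert i S) =
        - (koszul_sign j S * koszul_sign i (insert j S) :: 'a)"
      using * assms(2) by (intro koszul_sign_anticomm) auto
    finally show "koszul_sign i S * X i * (koszul_sign j (insert i S) * X j * w (insert j (insert i S))) =
          - (koszul_sign j S * X j * (koszul_sign i (insert j S) * X i * w (insert i (insert j S))))"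
      by (simp add: algebra_simps)
  qed (use assms in simp)
  finally show ?thesis .
qed

lemma koszul_add: "koszul N X (\<lambda>S. v S + w S) S = koszul N X v S + koszul N X w S"
  by (simp add: koszul_def sum.distrib algebra_simps)

lemma koszul_mult: "koszul N X (\<lambda>S. a * w S) S = a * koszul N X w S"
  by (simp add: koszul_def sum_distrib_left algebra_simps)

lemma koszul_sum: "koszul N X (\<lambda>S. \<Sum>j\<in>A. w j S) S = (\<Sum>j\<in>A. koszul N X (w j) S)"
  by (induction A rule: infinite_finite_induct) (simp_all add: koszul_add, simp_all add: koszul_def)

text \<open>This is d e_j + e_j d = X_j, so \<open>X j\<close> acts as zero on homology. Terms
  removing an index other than j cancel by anticommutation, and the term of index j
  survives.\<close>

lemma koszul_homotopy:
  assumes fin: "finite N" "S \<subseteq> N" and j: "j \<in> N"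
  shows "koszul N X (koszul_homotopy j w) S + koszul_homotopy j (koszul N X w) S = X j * w S"
proof (cases "j \<in> S")
  case False
  have "koszul N X (koszul_homotopy j w) S =
        (\<Sum>i\<in>{j}. koszul_sign i S * X i * koszul_homotopy j w (insert i S))"
    unfolding koszul_def using fin j False
    by (intro sum.mono_neutral_right) (auto simp: koszul_homotopy_def)
  also have "\<dots> = (koszul_sign j S * koszul_sign j S) * (X j * w S)"
    using False by (simp add: koszul_homotopy_def algebra_simps)
  finally show ?thesis using False by (simp add: koszul_homotopy_def)
next
  case True
  define S' where "S' = S - {j}"
  have S: "S = insert j S'" "j \<notin> S'" using True by (auto simp: S'_def)
  have "finite S'" using fin by (auto simp: S'_def intro: finite_subset)
  have 1: "koszul N X (koszul_homotopy j w) S =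
        (\<Sum>i\<in>N - S. - (koszul_sign j S' * koszul_sign i S' * X i * w (insert i S')))"
    unfolding koszul_def
  proof (rule sum.cong [OF refl])
    fix i assume i: "i \<in> N - S"
    then have "insert i S - {j} = insert i S'" using S by auto
    then have "koszul_sign i S * X i * koszul_homotopy j w (insert i S) =
        (koszul_sign i (insert j S') * koszul_sign j (insert i S')) * (X i * w (insert i S'))"
      using True S by (simp add: koszul_homotopy_def algebra_simps)
    also have "koszul_sign i (insert j S') * koszul_sign j (insert i S') =
        - (koszul_sign i S' * koszul_sign j S' :: 'a)"
      using i S \<open>finite S'\<close> by (intro koszul_sign_anticomm') auto
    finally show "koszul_sign i S * X i * koszul_homotopy j w (insert i S) =
        - (koszul_sign j S' * koszul_sign i S' * X i * w (insert i S'))"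
      by (simp add: algebra_simps)
  qed
  have "N - S' = insert j (N - S)" using S j by auto
  then have "koszul N X w S' = (\<Sum>i\<in>insert j (N - S). koszul_sign i S' * X i * w (insert i S'))"
    by (simp only: koszul_def)
  also have "\<dots> = koszul_sign j S' * X j * w (insert j S') +
      (\<Sum>i\<in>N - S. koszul_sign i S' * X i * w (insert i S'))"
    using fin True by (intro sum.insert) auto
  also have "insert j S' = S" using S by simp
  finally have "koszul N X w S' = koszul_sign j S' * X j * w S +
      (\<Sum>i\<in>N - S. koszul_sign i S' * X i * w (insert i S'))" .
  then have "koszul_homotopy j (koszul N X w) S =
      (koszul_sign j S' * koszul_sign j S') * (X j * w S) +
      (\<Sum>i\<in>N - S. koszul_sign j S' * koszul_sign i S' * X i * w (insert i S'))"
    using True by (simp add: koszul_homotopy_def S'_def sum_distrib_left algebra_simps)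
  then show ?thesis by (simp add: 1 sum_negf)
qed

text \<open>By the homotopy y annihilates the homology of R/J. The long exact sequence of
  multiplication by y then makes the connecting map from degree i + 1 over R/(J + (y)) onto degree i
  over R/J surjective. The proof carries this out on representatives.\<close>

lemma koszul_exact_adjoin:
  assumes J: "is_ideal J" and fin: "finite N"
    and y: "y - (\<Sum>j\<in>N. c j * X j) \<in> J" and reg: "regular_mod J y"
    and exact: "koszul_exact N X (adjoin J y) (Suc i)"
  shows "koszul_exact N X J i"
  unfolding koszul_exact_def
proof (intro allI impI)
  fix w assume cycle: "\<forall>S\<subseteq>N. Suc (card S) = i \<longrightarrow> koszul N X w S \<in> J"
  \<comment> \<open>The null homotopy of y applied to w: its differential is y w modulo J, so it is
    a cycle modulo J + (y) which the connecting map sends to w.\<close>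
  define u where "u = (\<lambda>S. \<Sum>j\<in>N. c j * koszul_homotopy j w S)"
  have u: "y * w S - koszul N X u S \<in> J" if S: "S \<subseteq> N" "card S = i" for S
  proof -
    have hom: "koszul_homotopy j (koszul N X w) S \<in> J" for j
    proof (cases "j \<in> S")
      case True
      have "finite S" using S fin finite_subset by blast
      then have "Suc (card (S - {j})) = i" using S True by (metis card.remove)
      then have "koszul N X w (S - {j}) \<in> J" using cycle S by blast
      then show ?thesis using True J by (simp add: koszul_homotopy_def is_ideal_mult)
    qed (use J in \<open>simp add: koszul_homotopy_def is_ideal_zero\<close>)
    have "koszul N X u S = (\<Sum>j\<in>N. c j * (X j * w S - koszul_homotopy j (koszul N X w) S))"
      unfolding u_def koszul_sum koszul_mult
      by (rule sum.cong) (simp_all flip: koszul_homotopy [OF fin S(1), of _ X w])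
    then have "y * w S - koszul N X u S =
        (y - (\<Sum>j\<in>N. c j * X j)) * w S + (\<Sum>j\<in>N. c j * koszul_homotopy j (koszul N X w) S)"
      by (simp add: algebra_simps sum_subtractf sum_distrib_left sum_distrib_right)
    then show ?thesis using J y hom
      by (simp add: is_ideal_add is_ideal_mult is_ideal_mult_right is_ideal_sum)
  qed
  have "koszul N X u S \<in> adjoin J y" if "S \<subseteq> N" "Suc (card S) = Suc i" for S
  proof -
    have "koszul N X u S = - (y * w S - koszul N X u S) + w S * y" by (simp add: algebra_simps)
    then show ?thesis unfolding adjoin_def
      using is_ideal_uminus [OF J u [of S]] that by blast
  qed
  then have "\<forall>S\<subseteq>N. Suc (card S) = Suc i \<longrightarrow> koszul N X u S \<in> adjoin J y" by simp
  from koszul_exactD [OF exact this]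
  obtain v where v: "\<forall>S\<subseteq>N. card S = Suc i \<longrightarrow> u S - koszul N X v S \<in> adjoin J y" ..
  have "\<forall>S. \<exists>b. S \<subseteq> N \<and> card S = Suc i \<longrightarrow> u S - koszul N X v S - y * b \<in> J"
  proof
    fix S
    show "\<exists>b. S \<subseteq> N \<and> card S = Suc i \<longrightarrow> u S - koszul N X v S - y * b \<in> J"
    proof (cases "S \<subseteq> N \<and> card S = Suc i")
      case True
      then obtain a b where "u S - koszul N X v S = a + b * y" "a \<in> J"
        using v unfolding adjoin_def by blast
      then show ?thesis by (intro exI [of _ b]) (simp add: algebra_simps)
    qed auto
  qed
  from choice [OF this]
  obtain b where "\<forall>S. S \<subseteq> N \<and> card S = Suc i \<longrightarrow> u S - koszul N X v S - y * b S \<in> J" ..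
  then have b: "\<And>S. S \<subseteq> N \<Longrightarrow> card S = Suc i \<Longrightarrow> u S - koszul N X v S - y * b S \<in> J"
    by simp
  have "w S - koszul N X b S \<in> J" if S: "S \<subseteq> N" "card S = i" for S
  proof -
    \<comment> \<open>\<open>r\<close> collects the error, so that u = r + d v + y b holds exactly.
      On S the differential of \<open>r\<close> sees only sets of size i + 1, where \<open>r\<close>
      lies in J.\<close>
    define r where "r = (\<lambda>S. u S - koszul N X v S - y * b S)"
    have finS: "finite S" using S fin finite_subset by blast
    have "koszul N X r S \<in> J"
      unfolding koszul_def [of N X r]
    proof (intro is_ideal_sum [OF J] is_ideal_mult [OF J])
      fix j assume "j \<in> N - S"
      then show "r (insert j S) \<in> J" unfolding r_def using S finS by (intro b) auto
    qed
    moreover have "koszul N X u S = koszul N X (\<lambda>S. r S + (koszul N X v S + y * b S)) S"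
      by (simp add: r_def)
    then have "koszul N X u S = koszul N X r S + y * koszul N X b S"
      using koszul_square [OF fin finS, of X v] by (simp add: koszul_add koszul_mult)
    then have "y * (w S - koszul N X b S) = (y * w S - koszul N X u S) + koszul N X r S"
      by (simp add: algebra_simps)
    ultimately have "y * (w S - koszul N X b S) \<in> J" using u [OF S] is_ideal_add [OF J] by simp
    then show ?thesis using reg by (simp add: regular_mod_def)
  qed
  then show "\<exists>v. \<forall>S\<subseteq>N. card S = i \<longrightarrow> w S - koszul N X v S \<in> J"
    by (intro exI [of _ b]) simp
qed

text \<open>Above degree |N| there are no chains, hence exactness; each element of the sequence
  extends it one degree down.\<close>

lemma koszul_exact_regular_seq:
  assumes "is_ideal J" "finite N" "regular_seq_mod J ys" "card N < length ys + i"
    and "\<And>y. y \<in> set ys \<Longrightarrow> \<exists>c. y - (\<Sum>j\<in>N. c j * X j) \<in> J"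
  shows "koszul_exact N X J i"
  using assms(1,3-5)
proof (induction ys arbitrary: J i)
  case Nil
  have "card S \<noteq> i" if "S \<subseteq> N" for S
    using card_mono [OF assms(2) that] Nil.prems(3) by simp
  then show ?case by (auto simp: koszul_exact_def)
next
  case (Cons y ys)
  obtain c where c: "y - (\<Sum>j\<in>N. c j * X j) \<in> J"
    using Cons.prems(4) [OF list.set_intros(1)] by metis
  have exact: "koszul_exact N X (adjoin J y) (Suc i)"
  proof (rule Cons.IH)
    show "is_ideal (adjoin J y)" by (rule is_ideal_adjoin [OF Cons.prems(1)])
    show "regular_seq_mod (adjoin J y) ys" using Cons.prems(2) by simp
    show "card N < length ys + Suc i" using Cons.prems(3) by simp
    fix y' assume "y' \<in> set ys"
    then obtain c where "y' - (\<Sum>j\<in>N. c j * X j) \<in> J"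
      using Cons.prems(4) [OF list.set_intros(2)] by metis
    then have "y' - (\<Sum>j\<in>N. c j * X j) \<in> adjoin J y"
      using adjoin_supset [OF Cons.prems(1)] by blast
    then show "\<exists>c. y' - (\<Sum>j\<in>N. c j * X j) \<in> adjoin J y" by (rule exI [of _ c])
  qed
  have "regular_mod J y" using Cons.prems(2) by simp
  then show ?case by (rule koszul_exact_adjoin [OF Cons.prems(1) assms(2) c _ exact])
qed

text \<open>
  The connecting map for \<open>0 \<rightarrow> R/(I \<inter> I') \<rightarrow> R/I \<oplus> R/I' \<rightarrow> R/(I + I') \<rightarrow> 0\<close>, where \<open>I\<close>, \<open>I'\<close> are
  generated by the \<open>X u\<close>, \<open>u \<in> U\<close>, and the \<open>X v\<close>, \<open>v \<in> V\<close>, turns the top class of \<open>U \<union> V\<close> into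
  the cycle used here. The additive maps \<open>\<epsilon>\<close>, \<open>\<pi>\<^sub>0\<close>, \<open>\<pi>\<^sub>1\<close> read off a constant and two linear
  coefficients.
\<close>

lemma koszul_not_exact:
  fixes X :: "nat \<Rightarrow> 'a::comm_ring_1" and \<epsilon> \<pi>\<^sub>0 \<pi>\<^sub>1 :: "'a \<Rightarrow> 'b::comm_ring_1"
  assumes J: "is_ideal J" and fin: "finite N" and W: "U \<union> V \<subseteq> N" "U \<inter> V = {}"
    and uv: "u\<^sub>0 \<in> U" "v\<^sub>0 \<in> V"
    and prod: "\<And>u v. u \<in> U \<Longrightarrow> v \<in> V \<Longrightarrow> X u * X v \<in> J"
    and add: "\<And>a b. \<pi>\<^sub>0 (a + b) = \<pi>\<^sub>0 a + \<pi>\<^sub>0 b" "\<And>a b. \<pi>\<^sub>1 (a + b) = \<pi>\<^sub>1 a + \<pi>\<^sub>1 b"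
    and var: "\<And>j a. \<pi>\<^sub>0 (X j * a) = (if j = u\<^sub>0 then \<epsilon> a else 0)"
             "\<And>j a. \<pi>\<^sub>1 (X j * a) = (if j = v\<^sub>0 then \<epsilon> a else 0)"
    and vanish: "\<And>a. a \<in> J \<Longrightarrow> \<pi>\<^sub>0 a = 0" "\<And>a. a \<in> J \<Longrightarrow> \<pi>\<^sub>1 a = 0"
    and one: "\<epsilon> 1 = 1"
    and i: "Suc i = card (U \<union> V)"
  shows "\<not> koszul_exact N X J i"
proof
  assume exact: "koszul_exact N X J i"
  \<comment> \<open>\<open>E\<close> is the basis element of U \<union> V, and \<open>w\<close>
    applies to it only the part of the differential with indices in V. So \<open>w\<close> is the
    signed sum of X_v times the basis element of (U \<union> V) - {v}.\<close>
  define E :: "nat set \<Rightarrow> 'a" where "E = (\<lambda>S. if S = U \<union> V then 1 else 0)"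
  define w where "w = koszul V X E"
  have finite [simp]: "finite U" "finite V" using W fin finite_subset by blast+
  have "koszul N X w S \<in> J" if S: "S \<subseteq> N" for S
  proof -
    have finS: "finite S" using S fin finite_subset by blast
    \<comment> \<open>The V-part of the differential kills \<open>w\<close> since it squares to
      zero. In the rest only indices from U can complete a set to U \<union> V, and they produce
      products X_u X_v in J.\<close>
    have "koszul N X w S = (\<Sum>j\<in>(V - S) \<union> (N - V - S). koszul_sign j S * X j * w (insert j S))"
      unfolding koszul_def using W by (intro sum.cong) auto
    also have "\<dots> = (\<Sum>j\<in>V - S. koszul_sign j S * X j * w (insert j S)) +
        (\<Sum>j\<in>N - V - S. koszul_sign j S * X j * w (insert j S))"
      using fin by (intro sum.union_disjoint) auto
    also have "(\<Sum>j\<in>V - S. koszul_sign j S * X j * w (insert j S)) = koszul V X w S"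
      by (simp add: koszul_def)
    also have "koszul V X w S = 0" unfolding w_def using finS by (simp add: koszul_square)
    finally have "koszul N X w S = (\<Sum>j\<in>N - V - S. koszul_sign j S * X j * w (insert j S))" by simp
    moreover have "koszul_sign j S * X j * w (insert j S) \<in> J" if j: "j \<in> N - V - S" for j
    proof -
      have "X j * (koszul_sign v (insert j S) * X v * E (insert v (insert j S))) \<in> J"
        if v: "v \<in> V - insert j S" for v
      proof (cases "insert v (insert j S) = U \<union> V")
        case True
        then have "j \<in> U" using j by auto
        have "X j * (koszul_sign v (insert j S) * X v * E (insert v (insert j S))) =
              (X j * X v) * (koszul_sign v (insert j S) * E (insert v (insert j S)))"
          by (simp add: algebra_simps)
        also have "\<dots> \<in> J" using v by (intro is_ideal_mult_right [OF J] prod \<open>j \<in> U\<close>) auto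
        finally show ?thesis .
      qed (use J in \<open>simp add: E_def is_ideal_zero\<close>)
      then have "X j * w (insert j S) \<in> J"
        unfolding w_def koszul_def sum_distrib_left by (intro is_ideal_sum [OF J])
      then show ?thesis using is_ideal_mult [OF J, of "X j * w (insert j S)" "koszul_sign j S"]
        by (simp add: mult.assoc)
    qed
    ultimately show ?thesis by (simp only:) (rule is_ideal_sum [OF J])
  qed
  then have "\<forall>S\<subseteq>N. Suc (card S) = i \<longrightarrow> koszul N X w S \<in> J" by simp
  from koszul_exactD [OF exact this]
  obtain b where "\<forall>S\<subseteq>N. card S = i \<longrightarrow> w S - koszul N X b S \<in> J" ..
  then have b: "\<And>S. S \<subseteq> N \<Longrightarrow> card S = i \<Longrightarrow> w S - koszul N X b S \<in> J" by simp
  \<comment> \<open>Of the terms of d b at (U \<union> V) - {j}, a map reading the coefficient of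
    X_j sees only the one of index j, which is X_j times the value of b on U \<union> V, up to
    sign.\<close>
  have lin: "\<pi> (koszul N X b (U \<union> V - {j})) = koszul_sign j (U \<union> V - {j}) * \<epsilon> (b (U \<union> V))"
    if j: "j \<in> U \<union> V" and \<pi>: "\<And>a b. \<pi> (a + b) = \<pi> a + \<pi> b"
      "\<And>l a. \<pi> (X l * a) = (if l = j then \<epsilon> a else 0)" for \<pi> :: "'a \<Rightarrow> 'b" and j
  proof -
    have z: "\<pi> 0 = 0" using \<pi>(1) [of 0 0] by simp
    have m: "\<pi> (- a) = - \<pi> a" for a using \<pi>(1) [of a "- a"] z by (simp add: eq_neg_iff_add_eq_0 add.commute)
    have s: "\<pi> (sum f A) = (\<Sum>l\<in>A. \<pi> (f l))" for f and A :: "nat set"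
      by (induction A rule: infinite_finite_induct) (simp_all add: z \<pi>)
    have p: "\<pi> (koszul_sign l S * a) = koszul_sign l S * \<pi> a" for l S a
      unfolding koszul_sign_def by (cases "even (card {i \<in> S. i < l})") (simp_all add: m)
    have "\<pi> (koszul N X b (U \<union> V - {j})) = (\<Sum>l\<in>N - (U \<union> V - {j}).
        koszul_sign l (U \<union> V - {j}) * (if l = j then \<epsilon> (b (insert l (U \<union> V - {j}))) else 0))"
      unfolding koszul_def s mult.assoc p \<pi>(2) ..
    also have "\<dots> = (\<Sum>l\<in>{j}.
        koszul_sign l (U \<union> V - {j}) * (if l = j then \<epsilon> (b (insert l (U \<union> V - {j}))) else 0))"
      using fin j W by (intro sum.mono_neutral_right) auto
    also have "\<dots> = koszul_sign j (U \<union> V - {j}) * \<epsilon> (b (U \<union> V))"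
      using j by (simp add: insert_absorb)
    finally show ?thesis .
  qed
  have card: "card (U \<union> V - {j}) = i" if "j \<in> U \<union> V" for j
    using that i by (simp add: card_Diff_singleton)
  have eq: "\<pi> (w S) = \<pi> (koszul N X b S)" if "S \<subseteq> N" "card S = i"
      "\<And>a b. \<pi> (a + b) = \<pi> a + \<pi> b" "\<And>a. a \<in> J \<Longrightarrow> \<pi> a = 0" for \<pi> :: "'a \<Rightarrow> 'b" and S
    using that(3) [of "w S - koszul N X b S" "koszul N X b S"] that(4) [OF b [OF that(1,2)]] by simp
  have w: "w (U \<union> V - {j}) = (if j \<in> V then koszul_sign j (U \<union> V - {j}) * X j else 0)"
    if j: "j \<in> U \<union> V" for j
  proof -
    have "w (U \<union> V - {j}) = (\<Sum>l\<in>V - (U \<union> V - {j}). koszul_sign l (U \<union> V - {j}) * X l)"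
      unfolding w_def koszul_def E_def using j by (intro sum.cong) auto
    also have "V - (U \<union> V - {j}) = (if j \<in> V then {j} else {})" by auto
    finally show ?thesis by simp
  qed
  \<comment> \<open>At \<open>u\<^sub>0\<close> the cycle has no term, which forces the constant of
    b on U \<union> V to be 0. At \<open>v\<^sub>0\<close> it has X_v up to sign, which contradicts
    this.\<close>
  have "\<pi>\<^sub>0 (w (U \<union> V - {u\<^sub>0})) = koszul_sign u\<^sub>0 (U \<union> V - {u\<^sub>0}) * \<epsilon> (b (U \<union> V))"
    using eq [of "U \<union> V - {u\<^sub>0}" \<pi>\<^sub>0, OF _ _ add(1) vanish(1)] lin [of "u\<^sub>0" \<pi>\<^sub>0, OF _ add(1) var(1)]
      card [of u\<^sub>0] uv W by auto
  moreover have "w (U \<union> V - {u\<^sub>0}) = 0" using w [of u\<^sub>0] uv W by auto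
  moreover have "\<pi>\<^sub>0 0 = 0" using add(1) [of 0 0] by simp
  ultimately have "koszul_sign u\<^sub>0 (U \<union> V - {u\<^sub>0}) * (koszul_sign u\<^sub>0 (U \<union> V - {u\<^sub>0}) * \<epsilon> (b (U \<union> V))) = 0"
    by simp
  then have "\<epsilon> (b (U \<union> V)) = 0" by (simp flip: mult.assoc)
  then have "\<pi>\<^sub>1 (w (U \<union> V - {v\<^sub>0})) = 0"
    using eq [of "U \<union> V - {v\<^sub>0}" \<pi>\<^sub>1, OF _ _ add(2) vanish(2)] lin [of "v\<^sub>0" \<pi>\<^sub>1, OF _ add(2) var(2)]
      card [of v\<^sub>0] uv W by auto
  moreover have "w (U \<union> V - {v\<^sub>0}) = X v\<^sub>0 * koszul_sign v\<^sub>0 (U \<union> V - {v\<^sub>0})"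
    using w [of v\<^sub>0] uv by (simp add: mult.commute)
  ultimately have "\<epsilon> (koszul_sign v\<^sub>0 (U \<union> V - {v\<^sub>0})) = 0" using var by simp
  \<comment> \<open>The sign may be -1, and \<epsilon> respects it because \<epsilon> a is
    \<open>\<pi>\<^sub>1 (X v\<^sub>0 * a)\<close> with \<open>\<pi>\<^sub>1\<close>
    additive.\<close>
  moreover have "\<epsilon> (- a) = - \<epsilon> a" for a
  proof -
    have "\<epsilon> a + \<epsilon> (- a) = \<pi>\<^sub>1 (X v\<^sub>0 * a) + \<pi>\<^sub>1 (X v\<^sub>0 * (- a))" by (simp only: var if_True refl)
    also have "\<dots> = \<pi>\<^sub>1 0" by (simp flip: add)
    also have "\<dots> = 0" using add(2) [of 0 0] by simp
    finally show ?thesis by (simp add: eq_neg_iff_add_eq_0 add.commute)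
  qed
  then have "\<epsilon> (koszul_sign v\<^sub>0 (U \<union> V - {v\<^sub>0})) \<in> {1, - 1}"
    unfolding koszul_sign_def using one
    by (cases "even (card {i \<in> U \<union> V - {v\<^sub>0}. i < v\<^sub>0})") simp_all
  ultimately show False by auto
qed

section \<open>Power series in countably many variables\<close>

text \<open>
  All series in the variables \<open>X\<^sub>0, X\<^sub>1, \<dots>\<close>, so that the ring of the theorem becomes the quotient
  by the variables outside \<open>{1..n}\<close> and no carrier has to be mentioned.
\<close>

typedef (overloaded) 'k ps = "UNIV :: ('k::field) series set"
  morphisms ps_coeff Abs_ps ..

setup_lifting type_definition_ps

instantiation ps :: (field) comm_ring_1
begin

lift_definition zero_ps :: "'a ps" is "\<lambda>_. 0" .
lift_definition one_ps :: "'a ps" is "\<lambda>\<mu>. if \<mu> = {#} then 1 else 0" .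
lift_definition plus_ps :: "'a ps \<Rightarrow> 'a ps \<Rightarrow> 'a ps" is "\<lambda>f g \<mu>. f \<mu> + g \<mu>" .
lift_definition minus_ps :: "'a ps \<Rightarrow> 'a ps \<Rightarrow> 'a ps" is "\<lambda>f g \<mu>. f \<mu> - g \<mu>" .
lift_definition uminus_ps :: "'a ps \<Rightarrow> 'a ps" is "\<lambda>f \<mu>. - f \<mu>" .
lift_definition times_ps :: "'a ps \<Rightarrow> 'a ps \<Rightarrow> 'a ps" is
  "\<lambda>f g \<mu>. \<Sum>(\<alpha>, \<beta>) | \<alpha> + \<beta> = \<mu>. f \<alpha> * g \<beta>" .

instance
proof
  fix a b c :: "'a ps"
  show "a * b * c = a * (b * c)" by transfer (rule ext, rule power_series_mult_assoc)
  show "a * b = b * a" by transfer (rule ext, rule power_series_mult_comm)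
  show "1 * a = a" by transfer (rule ext, rule power_series_one_mult)
  show "(a + b) * c = a * c + b * c"
    by transfer (simp add: case_prod_beta algebra_simps sum.distrib)
  show "(0 :: 'a ps) \<noteq> 1" by transfer (auto dest: fun_cong [of _ _ "{#}"])
qed (transfer; simp add: algebra_simps)+

end

lemma ps_eqI: "(\<And>\<mu>. ps_coeff f \<mu> = ps_coeff g \<mu>) \<Longrightarrow> f = g"
  by transfer auto

lemma ps_coeff_zero [simp]: "ps_coeff 0 \<mu> = 0"
  by transfer simp

lemma ps_coeff_one: "ps_coeff 1 \<mu> = (if \<mu> = {#} then 1 else 0)"
  by transfer simp

lemma ps_coeff_add [simp]: "ps_coeff (f + g) \<mu> = ps_coeff f \<mu> + ps_coeff g \<mu>"
  by transfer simp

lemma ps_coeff_diff [simp]: "ps_coeff (f - g) \<mu> = ps_coeff f \<mu> - ps_coeff g \<mu>"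
  by transfer simp

lemma ps_coeff_uminus [simp]: "ps_coeff (- f) \<mu> = - ps_coeff f \<mu>"
  by transfer simp

lemma ps_coeff_mult: "ps_coeff (f * g) \<mu> = (\<Sum>(\<alpha>, \<beta>) | \<alpha> + \<beta> = \<mu>. ps_coeff f \<alpha> * ps_coeff g \<beta>)"
  by transfer simp

lemma ps_coeff_Abs [simp]: "ps_coeff (Abs_ps f) = f"
  by (simp add: Abs_ps_inverse)

lemma ps_coeff_mult_nonzeroE:
  assumes "ps_coeff (f * g) \<mu> \<noteq> 0"
  obtains \<alpha> \<beta> where "\<mu> = \<alpha> + \<beta>" "ps_coeff f \<alpha> \<noteq> 0" "ps_coeff g \<beta> \<noteq> 0"
proof -
  have "\<exists>p\<in>{(\<alpha>, \<beta>). \<alpha> + \<beta> = \<mu>}. (case p of (\<alpha>, \<beta>) \<Rightarrow> ps_coeff f \<alpha> * ps_coeff g \<beta>) \<noteq> 0"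
    using assms sum.neutral unfolding ps_coeff_mult by meson
  then show thesis using that by auto
qed

lemma ps_coeff_mult_empty: "ps_coeff (f * g) {#} = ps_coeff f {#} * ps_coeff g {#}"
proof -
  have "{(\<alpha>, \<beta>). \<alpha> + \<beta> = ({#} :: nat multiset)} = {({#}, {#})}" by auto
  then show ?thesis by (simp add: ps_coeff_mult)
qed

abbreviation ps_var :: "nat \<Rightarrow> ('k::field) ps" where
  "ps_var i \<equiv> Abs_ps (var i)"

lemma ps_coeff_var_mult:
  "ps_coeff (ps_var i * f) \<mu> = (if i \<in># \<mu> then ps_coeff f (\<mu> - {#i#}) else 0)"
proof -
  have "ps_coeff (ps_var i * f) \<mu> =
      (\<Sum>(\<alpha>, \<beta>) | \<alpha> + \<beta> = \<mu> \<and> \<alpha> = {#i#}. var i \<alpha> * ps_coeff f \<beta>)"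
    unfolding ps_coeff_mult ps_coeff_Abs
    by (rule sum.mono_neutral_right)
       (auto simp: var_def intro: finite_subset [OF _ finite_antidiagonal_mset] split: if_splits)
  moreover have "{(\<alpha>, \<beta>). \<alpha> + \<beta> = \<mu> \<and> \<alpha> = {#i#}} = (if i \<in># \<mu> then {({#i#}, \<mu> - {#i#})} else {})"
    by auto
  ultimately show ?thesis by (simp add: var_def)
qed

definition ps_const :: "'k::field \<Rightarrow> 'k ps" where
  "ps_const c = Abs_ps (\<lambda>\<mu>. if \<mu> = {#} then c else 0)"

lemma ps_coeff_const_mult [simp]: "ps_coeff (ps_const c * f) \<mu> = c * ps_coeff f \<mu>"
proof -
  have "ps_coeff (ps_const c * f) \<mu> =
      (\<Sum>(\<alpha>, \<beta>) \<in> {({#} :: nat multiset, \<mu>)}. (if \<alpha> = {#} then c else 0) * ps_coeff f \<beta>)"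
    unfolding ps_coeff_mult ps_const_def ps_coeff_Abs
    by (rule sum.mono_neutral_right) (auto intro: finite_antidiagonal_mset split: if_splits)
  then show ?thesis by simp
qed

lemma ps_const_0 [simp]: "ps_const 0 = 0"
  by (rule ps_eqI) (simp add: ps_const_def)

lemma ps_const_1 [simp]: "ps_const 1 = 1"
  by (rule ps_eqI) (simp add: ps_const_def ps_coeff_one)

text \<open>Solves f g = 1 at the monomial \<mu> for the coefficient of g there; the other
  coefficients of g involved belong to proper divisors of \<mu>.\<close>

function ps_inverse_coeff :: "('k::field) ps \<Rightarrow> nat multiset \<Rightarrow> 'k" where
  "ps_inverse_coeff f \<mu> =
     ((if \<mu> = {#} then 1 else 0) - (\<Sum>\<beta> | \<beta> \<subset># \<mu>. ps_coeff f (\<mu> - \<beta>) * ps_inverse_coeff f \<beta>))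
       / ps_coeff f {#}"
  by auto
termination
  by (relation "measure (\<lambda>(f, \<mu>). size \<mu>)") (auto intro: mset_subset_size)

declare ps_inverse_coeff.simps [simp del]

lemma ps_unit:
  assumes "ps_coeff f {#} \<noteq> 0"
  shows "\<exists>g. f * g = 1"
proof (rule exI [of _ "Abs_ps (ps_inverse_coeff f)"], rule ps_eqI)
  fix \<mu> :: "nat multiset"
  let ?g = "ps_inverse_coeff f"
  have fin: "finite {\<beta>. \<beta> \<subset># \<mu>}"
    by (rule finite_subset [OF _ finite_imageI [OF finite_antidiagonal_mset [of \<mu>], of fst]])
       (force simp: image_iff subset_mset.less_le mset_subset_eq_exists_conv)
  have "ps_coeff (f * Abs_ps ?g) \<mu> = (\<Sum>\<beta>\<in>insert \<mu> {\<beta>. \<beta> \<subset># \<mu>}. ps_coeff f (\<mu> - \<beta>) * ?g \<beta>)"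
    unfolding ps_coeff_mult ps_coeff_Abs
    by (rule sum.reindex_bij_witness [where i = "\<lambda>\<beta>. (\<mu> - \<beta>, \<beta>)" and j = snd])
       (auto simp: subset_mset.le_less)
  also have "\<dots> = ps_coeff f {#} * ?g \<mu> + (\<Sum>\<beta> | \<beta> \<subset># \<mu>. ps_coeff f (\<mu> - \<beta>) * ?g \<beta>)"
    using fin by simp
  also have "\<dots> = ps_coeff 1 \<mu>"
    using assms by (subst ps_inverse_coeff.simps) (simp add: ps_coeff_one)
  finally show "ps_coeff (f * Abs_ps ?g) \<mu> = ps_coeff 1 \<mu>" .
qed

section \<open>Ideals generated by variables and linear forms\<close>

text \<open>Described by supports, so that \<open>V\<close> may be infinite, as for the complement
  of {1..n}. For infinite \<open>V\<close> it also contains infinite sums of variables and exceeds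
  the ideal they generate.\<close>

definition var_ideal :: "nat set \<Rightarrow> ('k::field) ps set" where
  "var_ideal V = {f. \<forall>\<mu>. ps_coeff f \<mu> \<noteq> 0 \<longrightarrow> set_mset \<mu> \<inter> V \<noteq> {}}"

definition var_free :: "nat set \<Rightarrow> ('k::field) ps set" where
  "var_free V = {f. \<forall>\<mu>. ps_coeff f \<mu> \<noteq> 0 \<longrightarrow> set_mset \<mu> \<inter> V = {}}"

definition ps_restrict :: "(nat multiset \<Rightarrow> bool) \<Rightarrow> ('k::field) ps \<Rightarrow> 'k ps" where
  "ps_restrict Q f = Abs_ps (\<lambda>\<mu>. if Q \<mu> then ps_coeff f \<mu> else 0)"

lemma ps_coeff_restrict [simp]: "ps_coeff (ps_restrict Q f) \<mu> = (if Q \<mu> then ps_coeff f \<mu> else 0)"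
  by (simp add: ps_restrict_def)

lemma is_ideal_var_ideal: "is_ideal (var_ideal V)"
proof (rule is_idealI)
  fix r f :: "'a ps" assume f: "f \<in> var_ideal V"
  show "r * f \<in> var_ideal V"
    unfolding var_ideal_def
  proof safe
    fix \<mu> assume "ps_coeff (r * f) \<mu> \<noteq> 0" and disj: "set_mset \<mu> \<inter> V = {}"
    from this(1) obtain \<alpha> \<beta> where "\<mu> = \<alpha> + \<beta>" "ps_coeff f \<beta> \<noteq> 0"
      by (rule ps_coeff_mult_nonzeroE)
    then show False using f disj by (auto simp: var_ideal_def)
  qed
next
  fix f g :: "'a ps" assume "f \<in> var_ideal V" "g \<in> var_ideal V"
  then have "ps_coeff f \<mu> = 0 \<and> ps_coeff g \<mu> = 0" if "set_mset \<mu> \<inter> V = {}" for \<mu>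
    using that unfolding var_ideal_def by blast
  then show "f + g \<in> var_ideal V" by (auto simp: var_ideal_def)
qed (simp add: var_ideal_def)

lemma var_ideal_mono: "V \<subseteq> W \<Longrightarrow> var_ideal V \<subseteq> var_ideal W"
  by (force simp: var_ideal_def)

lemma ps_var_in_var_ideal [intro]: "i \<in> V \<Longrightarrow> ps_var i \<in> var_ideal V"
  by (auto simp: var_ideal_def var_def)

lemma ps_var_mult_in_var_ideal: "i \<in> V \<or> j \<in> V \<Longrightarrow> ps_var i * ps_var j \<in> var_ideal V"
  using is_ideal_mult [OF is_ideal_var_ideal] is_ideal_mult_right [OF is_ideal_var_ideal] by blast

text \<open>Monomials of f meeting V go to the first summand. A remaining one meets W outside V,
  hence also Z. This gives P_1 + (P_2 \<inter> P_3) = P_1 + P_2.\<close>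

lemma ideal_sum_var_ideal_Int:
  assumes "W - V \<subseteq> Z"
  shows "ideal_sum (var_ideal V) (var_ideal W \<inter> var_ideal Z) = var_ideal (V \<union> W)"
proof (intro equalityI subsetI)
  fix f :: "'a ps" assume f: "f \<in> var_ideal (V \<union> W)"
  let ?Q = "\<lambda>\<mu>. set_mset \<mu> \<inter> V \<noteq> {}"
  have "f = ps_restrict ?Q f + ps_restrict (\<lambda>\<mu>. \<not> ?Q \<mu>) f" by (rule ps_eqI) simp
  moreover have "ps_restrict ?Q f \<in> var_ideal V" by (simp add: var_ideal_def)
  moreover have "ps_restrict (\<lambda>\<mu>. \<not> ?Q \<mu>) f \<in> var_ideal W" using f by (auto simp: var_ideal_def)
  moreover have "ps_restrict (\<lambda>\<mu>. \<not> ?Q \<mu>) f \<in> var_ideal Z"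
    using f assms unfolding var_ideal_def by (auto; blast)
  ultimately show "f \<in> ideal_sum (var_ideal V) (var_ideal W \<inter> var_ideal Z)"
    unfolding ideal_sum_def by blast
next
  fix f :: "'a ps" assume "f \<in> ideal_sum (var_ideal V) (var_ideal W \<inter> var_ideal Z)"
  then obtain g h where "f = g + h" "g \<in> var_ideal V" "h \<in> var_ideal W"
    unfolding ideal_sum_def by blast
  then have "g \<in> var_ideal (V \<union> W)" "h \<in> var_ideal (V \<union> W)" by (auto simp: var_ideal_def)
  then show "f \<in> var_ideal (V \<union> W)"
    unfolding \<open>f = g + h\<close> by (rule is_ideal_add [OF is_ideal_var_ideal])
qed

lemma ideal_sum_var_ideal: "ideal_sum (var_ideal V) (var_ideal W) = var_ideal (V \<union> W)"
  using ideal_sum_var_ideal_Int [of W V W] by simp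

text \<open>In y + c x the variable \<open>y\<close> is the one to be eliminated; c = 0 covers a
  single variable.\<close>

definition ps_linear :: "'k::field \<Rightarrow> nat \<Rightarrow> nat \<Rightarrow> 'k ps" where
  "ps_linear c x y = ps_var y + ps_const c * ps_var x"

text \<open>The coefficient of g at \<nu> is tied to that at y \<nu> / x, of smaller degree in x.
  Division and its uniqueness are inductions on this degree.\<close>

lemma ps_coeff_linear_mult:
  assumes "x \<noteq> y"
  shows "ps_coeff (ps_linear c x y * g) (add_mset y \<nu>) =
    ps_coeff g \<nu> + c * (if x \<in># \<nu> then ps_coeff g (add_mset y (\<nu> - {#x#})) else 0)"
proof -
  have "ps_linear c x y * g = ps_var y * g + ps_const c * (ps_var x * g)"
    by (simp add: ps_linear_def algebra_simps)
  then show ?thesis using assms by (simp add: ps_coeff_var_mult del: mult_cancel_left)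
qed

text \<open>Coefficients of the quotient in the division by \<open>y + c x\<close>, monic in \<open>y\<close>; \<open>k\<close> is the \<open>x\<close>-degree of \<open>\<nu>\<close>.\<close>

primrec quot_coeff :: "'k::field \<Rightarrow> nat \<Rightarrow> nat \<Rightarrow> 'k ps \<Rightarrow> nat \<Rightarrow> nat multiset \<Rightarrow> 'k" where
  "quot_coeff c x y f 0 \<nu> = ps_coeff f (add_mset y \<nu>)"
| "quot_coeff c x y f (Suc k) \<nu> =
     ps_coeff f (add_mset y \<nu>) - c * quot_coeff c x y f k (add_mset y (\<nu> - {#x#}))"

text \<open>Weierstrass division by y + c x with remainder free of y. The quotient avoids Y as f
  does: unless c = 0, replacing \<nu> by y \<nu> / x removes no variable of Y.\<close>

lemma linear_division:
  assumes "x \<noteq> y" and f: "f \<in> var_free Y" and x: "c = 0 \<or> x \<notin> Y"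
  shows "\<exists>g\<in>var_free Y. f - ps_linear c x y * g \<in> var_free {y}"
proof -
  define g where "g = Abs_ps (\<lambda>\<nu>. quot_coeff c x y f (count \<nu> x) \<nu>)"
  have free: "quot_coeff c x y f k \<nu> = 0" if "set_mset \<nu> \<inter> Y \<noteq> {}" for k \<nu>
    using that
  proof (induction k arbitrary: \<nu>)
    case 0
    then show ?case using f by (force simp: var_free_def)
  next
    case (Suc k)
    have "ps_coeff f (add_mset y \<nu>) = 0" using Suc.prems f by (force simp: var_free_def)
    moreover have "c * quot_coeff c x y f k (add_mset y (\<nu> - {#x#})) = 0"
    proof (cases "c = 0")
      case False
      obtain z where z: "z \<in># \<nu>" "z \<in> Y" using Suc.prems by auto
      then have "z \<in># \<nu> - {#x#}" using x False by (auto simp: in_diff_count)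
      then show ?thesis using Suc.IH [of "add_mset y (\<nu> - {#x#})"] z by auto
    qed simp
    ultimately show ?case by simp
  qed
  have "ps_coeff (ps_linear c x y * g) (add_mset y \<nu>) = ps_coeff f (add_mset y \<nu>)" for \<nu>
  proof (cases "x \<in># \<nu>")
    case True
    then obtain k where "count \<nu> x = Suc k" by (metis count_greater_zero_iff gr0_implies_Suc)
    then show ?thesis using True assms(1) by (simp add: ps_coeff_linear_mult g_def)
  next
    case False
    then have "count \<nu> x = 0" by (simp add: not_in_iff)
    then show ?thesis using False assms(1) by (simp add: ps_coeff_linear_mult g_def)
  qed
  then have "ps_coeff (f - ps_linear c x y * g) \<mu> = 0" if "y \<in># \<mu>" for \<mu>
    using multi_member_split [OF that] by auto
  then have "f - ps_linear c x y * g \<in> var_free {y}" by (auto simp: var_free_def)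
  moreover have "g \<in> var_free Y" using free by (auto simp: var_free_def g_def)
  ultimately show ?thesis by blast
qed

text \<open>Uniqueness of the division: the product has no coefficients at multiples of y, so those
  of g vanish by induction on the degree in x.\<close>

lemma linear_mult_free_imp_zero:
  assumes "x \<noteq> y" and "ps_linear c x y * g \<in> var_free {y}"
  shows "g = 0"
proof (rule ps_eqI)
  fix \<nu>
  have zero: "ps_coeff (ps_linear c x y * g) (add_mset y \<nu>) = 0" for \<nu>
    using assms(2) by (force simp: var_free_def)
  have "ps_coeff g \<nu> = 0"
  proof (induction "count \<nu> x" arbitrary: \<nu>)
    case 0
    then have "x \<notin># \<nu>" by (simp add: not_in_iff)
    then show ?case using zero [of \<nu>] assms(1) by (simp add: ps_coeff_linear_mult)
  next
    case (Suc k)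
    have "ps_coeff g (add_mset y (\<nu> - {#x#})) = 0" using Suc.hyps assms(1) by simp
    then show ?case using zero [of \<nu>] assms(1)
      by (simp add: ps_coeff_linear_mult split: if_splits)
  qed
  then show "ps_coeff g \<nu> = ps_coeff 0 \<nu>" by simp
qed

lemma var_free_diff:
  assumes "f \<in> var_free Y" "g \<in> var_free Y"
  shows "f - g \<in> var_free Y"
proof -
  have "ps_coeff f \<mu> = 0 \<and> ps_coeff g \<mu> = 0" if "set_mset \<mu> \<inter> Y \<noteq> {}" for \<mu>
    using that assms unfolding var_free_def by blast
  then have "set_mset \<mu> \<inter> Y = {}" if "ps_coeff (f - g) \<mu> \<noteq> 0" for \<mu>
    using that by (metis ps_coeff_diff diff_self)
  then show ?thesis unfolding var_free_def by blast
qed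

lemma var_free_mult: "f \<in> var_free Y \<Longrightarrow> g \<in> var_free Y \<Longrightarrow> f * g \<in> var_free Y"
  by (auto simp: var_free_def elim!: ps_coeff_mult_nonzeroE) blast+

lemma linear_var_free:
  assumes "y \<notin> Y" "c = 0 \<or> x \<notin> Y"
  shows "ps_linear c x y \<in> var_free Y"
  using assms by (auto simp: var_free_def ps_linear_def var_def split: if_splits)

text \<open>Every class modulo \<open>J\<close> has exactly one representative free of the variables
  in \<open>Y\<close>, so R/J resembles the series ring in the other variables.\<close>

definition complements :: "('k::field) ps set \<Rightarrow> nat set \<Rightarrow> bool" where
  "complements J Y \<longleftrightarrow> is_ideal J \<and> J \<inter> var_free Y = {0} \<and> (\<forall>f. \<exists>r\<in>var_free Y. f - r \<in> J)"

lemma complements_var_ideal: "complements (var_ideal V) V"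
  unfolding complements_def
proof (intro conjI allI)
  show "var_ideal V \<inter> var_free V = {0 :: 'a ps}"
    by (auto simp: var_ideal_def var_free_def intro!: ps_eqI)
  fix f :: "'a ps"
  let ?r = "ps_restrict (\<lambda>\<mu>. set_mset \<mu> \<inter> V = {}) f"
  have "?r \<in> var_free V" "f - ?r \<in> var_ideal V" by (auto simp: var_ideal_def var_free_def)
  then show "\<exists>r\<in>var_free V. f - r \<in> var_ideal V" by blast
qed (rule is_ideal_var_ideal)

text \<open>On representatives free of Y, multiplication by y + c x needs no reduction modulo J and
  is injective.\<close>

lemma complements_regular:
  assumes J: "complements J Y" and x: "x \<noteq> y" "y \<notin> Y" "c = 0 \<or> x \<notin> Y"
    and z: "z - ps_linear c x y \<in> J"
  shows "regular_mod J z"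
proof -
  have ideal: "is_ideal J" using J by (simp add: complements_def)
  have "regular_mod J (ps_linear c x y)"
    unfolding regular_mod_def
  proof (intro allI impI)
    fix f assume f: "ps_linear c x y * f \<in> J"
    obtain r where r: "r \<in> var_free Y" "f - r \<in> J" using J unfolding complements_def by blast
    have "ps_linear c x y * f - ps_linear c x y * (f - r) \<in> J"
      by (rule is_ideal_diff [OF ideal f is_ideal_mult [OF ideal r(2)]])
    then have "ps_linear c x y * r \<in> J" by (simp add: algebra_simps)
    then have "ps_linear c x y * r = 0"
      using J var_free_mult [OF linear_var_free [OF x(2,3)] r(1)] unfolding complements_def by blast
    then have "r = 0" using linear_mult_free_imp_zero [OF x(1), of c r] by (simp add: var_free_def)
    then show "f \<in> J" using r by simp
  qed
  then show ?thesis using regular_mod_cong [OF ideal z] by simp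
qed

text \<open>Adjoining z eliminates y: division by y + c x makes a representative free of y as well,
  and uniqueness of the division keeps the intersection trivial.\<close>

lemma complements_adjoin:
  assumes J: "complements J Y" and x: "x \<noteq> y" "y \<notin> Y" "c = 0 \<or> x \<notin> Y"
    and z: "z - ps_linear c x y \<in> J"
  shows "complements (adjoin J z) (insert y Y)"
proof -
  let ?l = "ps_linear c x y"
  have ideal: "is_ideal J" using J by (simp add: complements_def)
  have "complements (adjoin J ?l) (insert y Y)"
    unfolding complements_def
  proof (intro conjI allI)
    show "is_ideal (adjoin J ?l)" by (rule is_ideal_adjoin [OF ideal])
    have "f = 0" if f: "f \<in> adjoin J ?l" "f \<in> var_free (insert y Y)" for f
    proof -
      obtain i h where h: "f = i + h * ?l" "i \<in> J" using f unfolding adjoin_def by blast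
      obtain r where r: "r \<in> var_free Y" "h - r \<in> J" using J unfolding complements_def by blast
      have "i + ?l * (h - r) \<in> J"
        using h r by (intro is_ideal_add [OF ideal] is_ideal_mult [OF ideal])
      moreover have "i + ?l * (h - r) = f - ?l * r" using h by (simp add: algebra_simps)
      ultimately have J': "f - ?l * r \<in> J" by simp
      have "f \<in> var_free Y" using f(2) by (auto simp: var_free_def)
      then have "f - ?l * r \<in> var_free Y"
        using var_free_mult [OF linear_var_free [OF x(2,3)] r(1)] by (rule var_free_diff)
      then have "f - ?l * r = 0" using J J' unfolding complements_def by blast
      moreover from this have "?l * r \<in> var_free {y}" using f(2) by (auto simp: var_free_def)
      then have "r = 0" by (rule linear_mult_free_imp_zero [OF x(1)])
      ultimately show ?thesis by simp
    qed
    moreover have "0 \<in> adjoin J ?l \<inter> var_free (insert y Y)"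
      using is_ideal_zero [OF is_ideal_adjoin [OF ideal]] by (simp add: var_free_def)
    ultimately show "adjoin J ?l \<inter> var_free (insert y Y) = {0}" by blast
    fix f
    obtain r where r: "r \<in> var_free Y" "f - r \<in> J" using J unfolding complements_def by blast
    obtain g where g: "g \<in> var_free Y" "r - ?l * g \<in> var_free {y}"
      using linear_division [OF x(1) r(1) x(3)] by blast
    have "r - ?l * g \<in> var_free Y"
      using r(1) var_free_mult [OF linear_var_free [OF x(2,3)] g(1)] by (rule var_free_diff)
    then have "r - ?l * g \<in> var_free (insert y Y)" using g(2) by (auto simp: var_free_def)
    moreover have "f - (r - ?l * g) = (f - r) + g * ?l" by (simp add: algebra_simps)
    then have "f - (r - ?l * g) \<in> adjoin J ?l" unfolding adjoin_def using r by blast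
    ultimately show "\<exists>r\<in>var_free (insert y Y). f - r \<in> adjoin J ?l" by blast
  qed
  then show ?thesis using adjoin_cong [OF ideal z] by simp
qed

text \<open>The variables \<open>y i\<close> are eliminated one after the other. For nonzero c each
  \<open>x i\<close> must survive all these eliminations.\<close>

lemma complements_regular_seq:
  assumes "complements J Y" "distinct is" "inj_on y (set is)" "y ` set is \<inter> Y = {}"
    and "\<And>i. i \<in> set is \<Longrightarrow>
      x i \<noteq> y i \<and> (c = 0 \<or> x i \<notin> Y \<union> y ` set is) \<and> z i - ps_linear c (x i) (y i) \<in> J"
  shows "regular_seq_mod J (map z is)"
    and "complements (foldl adjoin J (map z is)) (y ` set is \<union> Y)"
proof -
  have "regular_seq_mod J (map z is) \<and> complements (foldl adjoin J (map z is)) (y ` set is \<union> Y)"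
    using assms
  proof (induction "is" arbitrary: J Y)
    case (Cons i "is")
    have i: "x i \<noteq> y i" "y i \<notin> Y" "c = 0 \<or> x i \<notin> Y" "z i - ps_linear c (x i) (y i) \<in> J"
      using Cons.prems(4) Cons.prems(5) [of i] by auto
    have J: "is_ideal J" using Cons.prems(1) by (simp add: complements_def)
    have "regular_seq_mod (adjoin J (z i)) (map z is) \<and>
        complements (foldl adjoin (adjoin J (z i)) (map z is)) (y ` set is \<union> insert (y i) Y)"
    proof (rule Cons.IH)
      show "complements (adjoin J (z i)) (insert (y i) Y)"
        by (rule complements_adjoin [OF Cons.prems(1) i])
      show "y ` set is \<inter> insert (y i) Y = {}"
        using Cons.prems(2-4) by (auto simp: inj_on_def)
      fix j assume "j \<in> set is"
      then show "x j \<noteq> y j \<and> (c = 0 \<or> x j \<notin> insert (y i) Y \<union> y ` set is) \<and>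
          z j - ps_linear c (x j) (y j) \<in> adjoin J (z i)"
        using Cons.prems(5) [of j] adjoin_supset [OF J, of "z i"] by auto
    qed (use Cons.prems in auto)
    then show ?case using complements_regular [OF Cons.prems(1) i] by simp
  qed simp
  then show "regular_seq_mod J (map z is)"
    and "complements (foldl adjoin J (map z is)) (y ` set is \<union> Y)" by simp_all
qed

section \<open>Depth of quotients of the power series ring\<close>

abbreviation ps_maximal :: "('k::field) ps set" where
  "ps_maximal \<equiv> {f. ps_coeff f {#} = 0}"

lemma is_ideal_ps_maximal: "is_ideal ps_maximal"
  by (rule is_idealI) (simp_all add: ps_coeff_mult_empty)

lemma var_ideal_subset_maximal: "var_ideal V \<subseteq> ps_maximal"
  by (force simp: var_ideal_def)

text \<open>Splits off the variables of V one at a time. This supplies the linear combinations for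
  the Koszul homotopy and the generators in \<open>foldl_adjoin_vars\<close>.\<close>

lemma var_ideal_decompose:
  assumes "finite V" "f \<in> var_ideal (V \<union> W)"
  shows "\<exists>c. f - (\<Sum>j\<in>V. c j * ps_var j) \<in> var_ideal W"
  using assms
proof (induction V arbitrary: f)
  case (insert v V)
  \<comment> \<open>The part of f divisible by X_v, divided by X_v.\<close>
  define g where "g = Abs_ps (\<lambda>\<nu>. ps_coeff f (add_mset v \<nu>))"
  have "ps_coeff (ps_var v * g) \<mu> = (if v \<in># \<mu> then ps_coeff f \<mu> else 0)" for \<mu>
    by (simp add: ps_coeff_var_mult g_def)
  then have "f - ps_var v * g \<in> var_ideal (V \<union> W)"
    using insert.prems unfolding var_ideal_def by (auto split: if_splits)
  then obtain c where c: "f - ps_var v * g - (\<Sum>j\<in>V. c j * ps_var j) \<in> var_ideal W"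
    using insert.IH by metis
  have "(\<Sum>j\<in>insert v V. (c(v := g)) j * ps_var j) = ps_var v * g + (\<Sum>j\<in>V. c j * ps_var j)"
    using insert.hyps by (auto simp: mult.commute intro!: sum.cong)
  then have "f - (\<Sum>j\<in>insert v V. (c(v := g)) j * ps_var j) \<in> var_ideal W"
    using c by (simp add: algebra_simps)
  then show ?case by (rule exI [of _ "c(v := g)"])
qed (auto intro: exI [of _ "\<lambda>_. 0"])

lemma foldl_adjoin_vars:
  "foldl adjoin (var_ideal W) (map ps_var vs) = var_ideal (set vs \<union> W)"
proof (intro equalityI subsetI)
  fix f :: "'a ps" assume "f \<in> foldl adjoin (var_ideal W) (map ps_var vs)"
  moreover have "foldl adjoin (var_ideal W) (map ps_var vs) \<subseteq> (var_ideal (set vs \<union> W) :: 'a ps set)"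
    by (rule foldl_adjoin_minimal) (auto simp: is_ideal_var_ideal intro: subsetD [OF var_ideal_mono, rotated])
  ultimately show "f \<in> var_ideal (set vs \<union> W)" by blast
next
  fix f :: "'a ps" assume "f \<in> var_ideal (set vs \<union> W)"
  then obtain c where c: "f - (\<Sum>j\<in>set vs. c j * ps_var j) \<in> var_ideal W"
    using var_ideal_decompose [of "set vs" f W] by auto
  let ?J = "foldl adjoin (var_ideal W) (map ps_var vs)"
  have J: "is_ideal ?J" by (rule is_ideal_foldl_adjoin [OF is_ideal_var_ideal])
  have "set (map ps_var vs) \<subseteq> ?J" by (rule set_subset_foldl_adjoin [OF is_ideal_var_ideal])
  then have "(\<Sum>j\<in>set vs. c j * ps_var j) \<in> ?J"
    by (intro is_ideal_sum [OF J] is_ideal_mult [OF J]) auto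
  moreover have "f - (\<Sum>j\<in>set vs. c j * ps_var j) \<in> ?J"
    using c foldl_adjoin_supset [OF is_ideal_var_ideal] by blast
  ultimately show "f \<in> ?J" using is_ideal_add [OF J] by fastforce
qed

text \<open>\<open>R\<close> is a nonzero quotient of the series ring in countably many variables.
  The assumption \<open>local\<close> places the kernel among the series without constant term,
  whose images form the maximal ideal.\<close>

locale ps_quotient = cring R
  for R :: "('r, 's) ring_scheme" (structure) and h :: "('k::field) ps \<Rightarrow> 'r" +
  assumes surj: "range h = carrier R"
    and hom_add: "h (f + g) = h f \<oplus> h g"
    and hom_mult: "h (f * g) = h f \<otimes> h g"
    and hom_one: "h 1 = \<one>"
    and local: "h f = \<zero> \<Longrightarrow> ps_coeff f {#} = 0"
begin

definition ker :: "'k ps set" where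
  "ker = {f. h f = \<zero>}"

lemma hom_closed [simp, intro]: "h f \<in> carrier R"
  using surj by blast

lemma hom_zero: "h 0 = \<zero>"
  using hom_add [of 0 0] by simp

lemma hom_uminus: "h (- f) = \<ominus> h f"
proof -
  have "h (- f) \<oplus> h f = \<zero>" using hom_add [of "- f" f] by (simp add: hom_zero)
  then show ?thesis by (simp add: minus_equality [symmetric])
qed

lemma hom_eq_iff: "h f = h g \<longleftrightarrow> f - g \<in> ker"
proof
  assume "h f = h g"
  then show "f - g \<in> ker" using hom_add [of f "- g"] by (simp add: ker_def hom_uminus r_neg)
next
  assume "f - g \<in> ker"
  then show "h f = h g" using hom_add [of "f - g" g] by (simp add: ker_def)
qed

lemma is_ideal_vimage:
  assumes "ideal L R"
  shows "is_ideal {f. h f \<in> L}"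
proof -
  interpret L: ideal L R by fact
  show ?thesis
    by (rule is_idealI) (simp_all add: hom_zero hom_add hom_mult L.I_l_closed)
qed

lemma is_ideal_ker: "is_ideal ker"
  using is_ideal_vimage [OF zeroideal] by (simp add: ker_def)

lemma ker_subset_maximal: "ker \<subseteq> ps_maximal"
  using local by (auto simp: ker_def)

lemma image_mem_iff:
  assumes "is_ideal L" "ker \<subseteq> L"
  shows "h f \<in> h ` L \<longleftrightarrow> f \<in> L"
proof
  assume "h f \<in> h ` L"
  then obtain g where "g \<in> L" "f - g \<in> L" using assms(2) by (auto simp: hom_eq_iff)
  then show "f \<in> L" using is_ideal_add [OF assms(1), of "f - g" g] by simp
qed simp

lemma ideal_image:
  assumes "is_ideal L"
  shows "ideal (h ` L) R"
proof (rule idealI)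
  show "subgroup (h ` L) (add_monoid R)"
  proof (rule add.subgroupI)
    show "h ` L \<subseteq> carrier R" by auto
    show "h ` L \<noteq> {}" using is_ideal_zero [OF assms] by blast
    fix a b assume "a \<in> h ` L" "b \<in> h ` L"
    then show "\<ominus> a \<in> h ` L" "a \<oplus> b \<in> h ` L"
      using is_ideal_uminus [OF assms] is_ideal_add [OF assms]
      by (auto simp flip: hom_uminus hom_add)
  qed
next
  fix a x assume a: "a \<in> h ` L" and "x \<in> carrier R"
  then obtain r where "x = h r" using surj by blast
  then show "x \<otimes> a \<in> h ` L" "a \<otimes> x \<in> h ` L"
    using a is_ideal_mult [OF assms] is_ideal_mult_right [OF assms] by (auto simp flip: hom_mult)
qed (rule ring_axioms)

text \<open>Both directions rest on minimality, of the generated ideal in R and of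
  \<open>foldl adjoin ker zs\<close>.\<close>

lemma genideal_image_iff: "h f \<in> Idl (h ` set zs) \<longleftrightarrow> f \<in> foldl adjoin ker zs"
proof
  let ?L = "foldl adjoin ker zs"
  have L: "is_ideal ?L" "ker \<subseteq> ?L" "set zs \<subseteq> ?L"
    using is_ideal_foldl_adjoin foldl_adjoin_supset set_subset_foldl_adjoin is_ideal_ker by blast+
  have "Idl (h ` set zs) \<subseteq> h ` ?L"
    using L by (intro genideal_minimal ideal_image image_mono)
  moreover assume "h f \<in> Idl (h ` set zs)"
  ultimately show "f \<in> ?L" using image_mem_iff [OF L(1,2)] by blast
next
  have I: "ideal (Idl (h ` set zs)) R" by (rule genideal_ideal) auto
  have "foldl adjoin ker zs \<subseteq> {f. h f \<in> Idl (h ` set zs)}"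
  proof (rule foldl_adjoin_minimal [OF is_ideal_ker is_ideal_vimage [OF I]])
    show "ker \<subseteq> {f. h f \<in> Idl (h ` set zs)}"
      using additive_subgroup.zero_closed [OF ideal.axioms(1) [OF I]] by (auto simp: ker_def)
    show "set zs \<subseteq> {f. h f \<in> Idl (h ` set zs)}"
      using genideal_self [of "h ` set zs"] by auto
  qed
  moreover assume "f \<in> foldl adjoin ker zs"
  ultimately show "h f \<in> Idl (h ` set zs)" by blast
qed

text \<open>The last quotient is nonzero because the kernel and the sequence lie in
  \<open>ps_maximal\<close>, which does not contain 1.\<close>

lemma regular_sequence_iff:
  assumes "set zs \<subseteq> ps_maximal"
  shows "regular_sequence R (map h zs) \<longleftrightarrow> regular_seq_mod ker zs"
proof -
  have "(\<forall>a\<in>carrier R. map h zs ! i \<otimes> a \<in> Idl (set (take i (map h zs))) \<longrightarrow>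
           a \<in> Idl (set (take i (map h zs)))) \<longleftrightarrow>
        regular_mod (foldl adjoin ker (take i zs)) (zs ! i)" if "i < length zs" for i
  proof -
    have eq: "set (take i (map h zs)) = h ` set (take i zs)" by (simp add: take_map)
    show ?thesis
      unfolding eq regular_mod_def surj [symmetric]
      using that by (simp add: genideal_image_iff flip: hom_mult)
  qed
  moreover have "Idl (h ` set zs) \<noteq> carrier R"
  proof
    assume "Idl (h ` set zs) = carrier R"
    then have "1 \<in> foldl adjoin ker zs" using genideal_image_iff [of 1 zs] by simp
    moreover have "foldl adjoin ker zs \<subseteq> ps_maximal"
      using assms by (intro foldl_adjoin_minimal is_ideal_ker is_ideal_ps_maximal ker_subset_maximal)
    ultimately show False by (auto simp: ps_coeff_one)
  qed
  ultimately show ?thesis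
    unfolding regular_sequence_def regular_seq_mod_nth by (auto simp: image_subset_iff)
qed

text \<open>A series with nonzero constant term is a unit, so no proper ideal contains its
  image.\<close>

lemma proper_ideal_subset:
  assumes "ideal L R" "L \<noteq> carrier R"
  shows "L \<subseteq> h ` ps_maximal"
proof
  fix x assume x: "x \<in> L"
  interpret L: ideal L R by fact
  obtain f where f: "x = h f" using L.Icarr [OF x] surj by blast
  have "ps_coeff f {#} = 0"
  proof (rule ccontr)
    assume "ps_coeff f {#} \<noteq> 0"
    then obtain g where "f * g = 1" using ps_unit by blast
    then have "\<one> = x \<otimes> h g" by (simp add: f flip: hom_mult hom_one)
    then have "\<one> \<in> L" using L.I_r_closed [OF x, of "h g"] by simp
    then show False using L.one_imp_carrier assms(2) by blast
  qed
  then show "x \<in> h ` ps_maximal" using f by blast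
qed

lemma the_maximal_ideal_eq: "the_maximal_ideal R = h ` ps_maximal"
  unfolding the_maximal_ideal_def
proof (rule the_equality)
  have "h 1 \<notin> h ` ps_maximal"
    by (subst image_mem_iff) (simp_all add: is_ideal_ps_maximal ker_subset_maximal ps_coeff_one)
  then have ne: "h ` ps_maximal \<noteq> carrier R" by (metis hom_closed)
  have I: "ideal (h ` ps_maximal) R" by (rule ideal_image [OF is_ideal_ps_maximal])
  show "maximalideal (h ` ps_maximal) R"
  proof (rule maximalidealI [OF I])
    show "carrier R \<noteq> h ` ps_maximal" using ne by simp
    fix L assume "ideal L R" "h ` ps_maximal \<subseteq> L"
    then show "L = h ` ps_maximal \<or> L = carrier R" using proper_ideal_subset by blast
  qed
  fix L assume "maximalideal L R"
  then interpret L: maximalideal L R .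
  have "L \<subseteq> h ` ps_maximal"
    using L.I_notcarr by (intro proper_ideal_subset L.is_ideal) auto
  moreover have "h ` ps_maximal \<subseteq> carrier R" by auto
  ultimately show "L = h ` ps_maximal" using L.I_maximal [OF I] ne by blast
qed

lemma depth_eqI:
  assumes le: "\<And>zs. set zs \<subseteq> ps_maximal \<Longrightarrow> regular_seq_mod ker zs \<Longrightarrow> length zs \<le> d"
    and ws: "set ws \<subseteq> ps_maximal" "regular_seq_mod ker ws" "length ws = d"
  shows "depth R = enat d"
  unfolding depth_def the_maximal_ideal_eq
proof (rule antisym)
  show "(SUP xs\<in>{xs. set xs \<subseteq> h ` ps_maximal \<and> regular_sequence R xs}. enat (length xs)) \<le> enat d"
  proof (rule SUP_least)
    fix xs assume xs: "xs \<in> {xs. set xs \<subseteq> h ` ps_maximal \<and> regular_sequence R xs}"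
    then have "xs \<in> lists (h ` ps_maximal)" by auto
    then obtain zs where zs: "xs = map h zs" "set zs \<subseteq> ps_maximal"
      unfolding lists_image by (auto simp: lists_eq_set)
    then show "enat (length xs) \<le> enat d"
      using le [of zs] xs regular_sequence_iff [of zs] by simp
  qed
  have "map h ws \<in> {xs. set xs \<subseteq> h ` ps_maximal \<and> regular_sequence R xs}"
    using ws regular_sequence_iff [of ws] by auto
  from SUP_upper [OF this, of "\<lambda>xs. enat (length xs)"]
  show "enat d \<le> (SUP xs\<in>{xs. set xs \<subseteq> h ` ps_maximal \<and> regular_sequence R xs}. enat (length xs))"
    using ws by simp
qed

text \<open>Proper quotients stay in the locale, so that T, the three T/P_i, A and A/I are treated
  alike, each with an explicit kernel.\<close>

lemma quotient:
  assumes L: "ideal L R" "L \<noteq> carrier R"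
  shows "ps_quotient (R Quot L) (\<lambda>f. L +> h f)"
    and "ps_quotient.ker (R Quot L) (\<lambda>f. L +> h f) = {f. h f \<in> L}"
proof -
  interpret L: ideal L R by fact
  have zero: "L +> h f = \<zero>\<^bsub>R Quot L\<^esub> \<longleftrightarrow> h f \<in> L" for f
    using L.rcos_const_imp_mem L.a_rcos_const by (auto simp: FactRing_def)
  show q: "ps_quotient (R Quot L) (\<lambda>f. L +> h f)"
  proof (intro ps_quotient.intro ps_quotient_axioms.intro)
    show "cring (R Quot L)" by (rule L.quotient_is_cring [OF is_cring])
    show "range (\<lambda>f. L +> h f) = carrier (R Quot L)"
      unfolding image_image [of "(+>) L" h UNIV, symmetric] surj
      by (auto simp: FactRing_def A_RCOSETS_def')
    fix f g
    show "L +> h (f + g) = (L +> h f) \<oplus>\<^bsub>R Quot L\<^esub> (L +> h g)"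
      using ring_hom_add [OF L.rcos_ring_hom] by (simp add: hom_add)
    show "L +> h (f * g) = (L +> h f) \<otimes>\<^bsub>R Quot L\<^esub> (L +> h g)"
      using ring_hom_mult [OF L.rcos_ring_hom] by (simp add: hom_mult)
    show "L +> h 1 = \<one>\<^bsub>R Quot L\<^esub>"
      using ring_hom_one [OF L.rcos_ring_hom] by (simp add: hom_one)
    assume "L +> h f = \<zero>\<^bsub>R Quot L\<^esub>"
    then have "h f \<in> h ` ps_maximal" using proper_ideal_subset [OF L] zero by blast
    then show "ps_coeff f {#} = 0"
      using image_mem_iff [OF is_ideal_ps_maximal ker_subset_maximal, of f] by simp
  qed
  show "ps_quotient.ker (R Quot L) (\<lambda>f. L +> h f) = {f. h f \<in> L}"
    unfolding ps_quotient.ker_def [OF q] zero ..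
qed

text \<open>A longer sequence would make the complex exact in degree |U \<union> V| - 1, against
  \<open>koszul_not_exact\<close>. There \<epsilon> is the constant term and the two linear maps
  read the coefficients at X_u and X_v.\<close>

lemma regular_seq_length_le:
  assumes out: "var_ideal (- N) \<subseteq> ker" and fin: "finite N"
    and W: "U \<union> V \<subseteq> N" "U \<inter> V = {}" "u \<in> U" "v \<in> V"
    and prod: "\<And>i j. i \<in> U \<Longrightarrow> j \<in> V \<Longrightarrow> ps_var i * ps_var j \<in> ker"
    and lin: "\<And>f. f \<in> ker \<Longrightarrow> ps_coeff f {#u#} = 0" "\<And>f. f \<in> ker \<Longrightarrow> ps_coeff f {#v#} = 0"
    and zs: "set zs \<subseteq> ps_maximal" "regular_seq_mod ker zs"
  shows "length zs + card (U \<union> V) \<le> Suc (card N)"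
proof (rule ccontr)
  assume *: "\<not> ?thesis"
  have "finite (U \<union> V)" "U \<union> V \<noteq> {}" using W fin finite_subset by auto
  then obtain i where i: "card (U \<union> V) = Suc i" by (metis card_gt_0_iff gr0_implies_Suc)
  have "koszul_exact N ps_var ker i"
  proof (rule koszul_exact_regular_seq [OF is_ideal_ker fin zs(2)])
    show "card N < length zs + i" using * i by simp
    fix y assume "y \<in> set zs"
    \<comment> \<open>As N and its complement cover all indices, this only says that y has no
      constant term.\<close>
    then have "y \<in> var_ideal (N \<union> - N)" using zs(1) by (auto simp: var_ideal_def)
    from var_ideal_decompose [OF fin this] obtain c
      where "y - (\<Sum>j\<in>N. c j * ps_var j) \<in> var_ideal (- N)" ..
    then have "y - (\<Sum>j\<in>N. c j * ps_var j) \<in> ker" using out by blast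
    then show "\<exists>c. y - (\<Sum>j\<in>N. c j * ps_var j) \<in> ker" by (rule exI [of _ c])
  qed
  moreover have "\<not> koszul_exact N ps_var ker i"
  proof (rule koszul_not_exact [OF is_ideal_ker fin W prod])
    show "ps_coeff (f + g) \<mu> = ps_coeff f \<mu> + ps_coeff g \<mu>" for f g :: "'k ps" and \<mu>
      by simp
    show "ps_coeff (ps_var j * f) {#u#} = (if j = u then ps_coeff f {#} else 0)"
      "ps_coeff (ps_var j * f) {#v#} = (if j = v then ps_coeff f {#} else 0)" for j f
      by (simp_all add: ps_coeff_var_mult)
    show "ps_coeff (1 :: 'k ps) {#} = 1" by (simp add: ps_coeff_one)
  qed (use lin i in auto)
  ultimately show False by simp
qed

end

definition series_of :: "nat \<Rightarrow> ('k::field) ps \<Rightarrow> 'k series" where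
  "series_of n f = ps_coeff (ps_restrict (\<lambda>\<mu>. set_mset \<mu> \<subseteq> {1..n}) f)"

lemma series_of_Abs: "t \<in> carrier (power_series_ring n) \<Longrightarrow> series_of n (Abs_ps t) = t"
  by (rule ext) (auto simp: series_of_def power_series_ring_def)

lemma
  shows ps_quotient_series_of: "ps_quotient (power_series_ring n) (series_of n :: ('k::field) ps \<Rightarrow> _)"
    and ker_series_of: "ps_quotient.ker (power_series_ring n) (series_of n :: 'k ps \<Rightarrow> _) =
      var_ideal (- {1..n})"
proof -
  show q: "ps_quotient (power_series_ring n) (series_of n :: 'k ps \<Rightarrow> _)"
  proof (intro ps_quotient.intro ps_quotient_axioms.intro cring_power_series_ring)
    have "series_of n f \<in> carrier (power_series_ring n)" for f :: "'k ps"
      by (simp add: series_of_def power_series_ring_def)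
    then show "range (series_of n :: 'k ps \<Rightarrow> _) = carrier (power_series_ring n)"
      using series_of_Abs by (metis image_subsetI rangeI subsetI subset_antisym)
    fix f g :: "'k ps"
    show "series_of n (f + g) = series_of n f \<oplus>\<^bsub>power_series_ring n\<^esub> series_of n g"
      by (auto simp: series_of_def power_series_ring_def)
    show "series_of n (f * g) = series_of n f \<otimes>\<^bsub>power_series_ring n\<^esub> series_of n g"
    proof (rule ext)
      fix \<mu>
      show "series_of n (f * g) \<mu> = (series_of n f \<otimes>\<^bsub>power_series_ring n\<^esub> series_of n g) \<mu>"
      proof (cases "set_mset \<mu> \<subseteq> {1..n}")
        case True
        then show ?thesis
          by (auto simp: series_of_def power_series_ring_def ps_coeff_mult intro!: sum.cong)
      next
        case False
        have "(\<Sum>(\<alpha>, \<beta>) | \<alpha> + \<beta> = \<mu>. series_of n f \<alpha> * series_of n g \<beta>) = 0"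
          using False by (intro sum.neutral) (auto simp: series_of_def subset_iff)
        then show ?thesis using False by (simp add: series_of_def power_series_ring_def)
      qed
    qed
    show "series_of n (1 :: 'k ps) = \<one>\<^bsub>power_series_ring n\<^esub>"
      by (auto simp: series_of_def power_series_ring_def ps_coeff_one)
    assume "series_of n f = \<zero>\<^bsub>power_series_ring n\<^esub>"
    then show "ps_coeff f {#} = 0"
      by (auto simp: series_of_def power_series_ring_def dest: fun_cong [of _ _ "{#}"])
  qed
  show "ps_quotient.ker (power_series_ring n) (series_of n :: 'k ps \<Rightarrow> _) = var_ideal (- {1..n})"
    unfolding ps_quotient.ker_def [OF q]
    by (auto simp: series_of_def power_series_ring_def var_ideal_def fun_eq_iff
        simp flip: disjoint_eq_subset_Compl)
qed

section \<open>The three prime ideals\<close>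

text \<open>Turns membership in a generated ideal into a condition on supports. The indices outside
  {1..n} enter because \<open>series_of\<close> sends their variables to zero.\<close>

lemma series_of_mem_genideal_iff:
  fixes f :: "('k::field) ps"
  assumes "S \<subseteq> {1..n}"
  shows "series_of n f \<in> Idl\<^bsub>power_series_ring n\<^esub> (var ` S) \<longleftrightarrow> f \<in> var_ideal (S \<union> - {1..n})"
proof -
  interpret ps_quotient "power_series_ring n :: 'k series ring" "series_of n"
    by (rule ps_quotient_series_of)
  define vs where "vs = sorted_list_of_set S"
  have "finite S" using assms finite_subset by blast
  then have S: "set vs = S" by (simp add: vs_def)
  have "series_of n (ps_var j :: 'k ps) = var j" if "j \<in> S" for j
    using assms that by (intro series_of_Abs var_in_carrier) auto
  then have "var ` S = series_of n ` set (map ps_var vs :: 'k ps list)" by (force simp: S image_image)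
  then show ?thesis
    using genideal_image_iff [of f "map ps_var vs"] by (simp add: ker_series_of foldl_adjoin_vars S)
qed

text \<open>
  In \<open>T\<close>, the element \<open>f\<close> multiplies \<open>T/Q\<^sub>1 \<oplus> T/Q\<^sub>2 \<oplus> T/Q\<^sub>3\<close> into the image of \<open>T\<close> iff every triple
  \<open>f b\<^sub>i\<close> can be lifted to one \<open>u\<close>.
\<close>

lemma conductor_var_ideal_iff:
  fixes f :: "('k::field) ps"
  assumes V: "V\<^sub>2 - V\<^sub>1 \<subseteq> V\<^sub>3" "V\<^sub>2 - V\<^sub>3 \<subseteq> V\<^sub>1"
  shows "(\<forall>b\<^sub>1 b\<^sub>2 b\<^sub>3. \<exists>u. u - f * b\<^sub>1 \<in> var_ideal V\<^sub>1 \<and> u - f * b\<^sub>2 \<in> var_ideal V\<^sub>2 \<and>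
            u - f * b\<^sub>3 \<in> var_ideal V\<^sub>3) \<longleftrightarrow>
         f \<in> var_ideal (V\<^sub>1 \<union> V\<^sub>2) \<inter> var_ideal (V\<^sub>2 \<union> V\<^sub>3)" (is "?L \<longleftrightarrow> ?R")
proof
  assume L: ?L
  \<comment> \<open>Two triples suffice: lifting f (1, 0, 0) splits f into parts for the first two
    ideals, and f (0, 0, 1) does so for the last two.\<close>
  from L [rule_format, of 1 0 0] obtain u
    where u: "u - f \<in> var_ideal V\<^sub>1" "u \<in> var_ideal V\<^sub>2" by auto
  have "f = - (u - f) + u" by simp
  then have "f \<in> ideal_sum (var_ideal V\<^sub>1) (var_ideal V\<^sub>2)"
    unfolding ideal_sum_def using u is_ideal_uminus [OF is_ideal_var_ideal] by blast
  moreover from L [rule_format, of 0 0 1] obtain u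
    where u: "u \<in> var_ideal V\<^sub>2" "u - f \<in> var_ideal V\<^sub>3" by auto
  have "f = u + (- (u - f))" by simp
  then have "f \<in> ideal_sum (var_ideal V\<^sub>2) (var_ideal V\<^sub>3)"
    unfolding ideal_sum_def using u is_ideal_uminus [OF is_ideal_var_ideal] by blast
  ultimately show ?R by (simp add: ideal_sum_var_ideal)
next
  assume R: ?R
  show ?L
  proof (intro allI)
    fix b\<^sub>1 b\<^sub>2 b\<^sub>3
    \<comment> \<open>This yields f b_2 + p_2 as a lift of the first two components.\<close>
    have "f * (b\<^sub>1 - b\<^sub>2) \<in> ideal_sum (var_ideal V\<^sub>1) (var_ideal V\<^sub>2)"
      using R by (simp add: ideal_sum_var_ideal is_ideal_mult_right [OF is_ideal_var_ideal])
    then obtain p\<^sub>1 p\<^sub>2 where p: "f * (b\<^sub>1 - b\<^sub>2) = p\<^sub>1 + p\<^sub>2" "p\<^sub>1 \<in> var_ideal V\<^sub>1" "p\<^sub>2 \<in> var_ideal V\<^sub>2"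
      unfolding ideal_sum_def by blast
    have "p\<^sub>2 \<in> var_ideal (V\<^sub>2 \<union> V\<^sub>3)" using p(3) by (auto simp: var_ideal_def)
    then have "f * (b\<^sub>2 - b\<^sub>3) + p\<^sub>2 \<in> var_ideal (V\<^sub>2 \<union> V\<^sub>3)"
      using R by (simp add: is_ideal_add is_ideal_mult_right is_ideal_var_ideal)
    also have "(var_ideal (V\<^sub>2 \<union> V\<^sub>3) :: 'k ps set) = ideal_sum (var_ideal V\<^sub>3) (var_ideal V\<^sub>2 \<inter> var_ideal V\<^sub>1)"
      by (simp add: ideal_sum_var_ideal_Int [OF V(2)] Un_commute)
    finally obtain p\<^sub>3 r where r: "f * (b\<^sub>2 - b\<^sub>3) + p\<^sub>2 = p\<^sub>3 + r" "p\<^sub>3 \<in> var_ideal V\<^sub>3"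
      "r \<in> var_ideal V\<^sub>2" "r \<in> var_ideal V\<^sub>1" unfolding ideal_sum_def by blast
    \<comment> \<open>Subtracting \<open>r\<close>, which is zero in the first two components,
      corrects the third.\<close>
    define u where "u = f * b\<^sub>2 + p\<^sub>2 - r"
    have "u - f * b\<^sub>1 = - (p\<^sub>1 + r)" "u - f * b\<^sub>2 = p\<^sub>2 - r" "u - f * b\<^sub>3 = p\<^sub>3"
      using p(1) r(1) by (simp_all add: u_def algebra_simps)
    then have "u - f * b\<^sub>1 \<in> var_ideal V\<^sub>1 \<and> u - f * b\<^sub>2 \<in> var_ideal V\<^sub>2 \<and> u - f * b\<^sub>3 \<in> var_ideal V\<^sub>3"
      using p(2,3) r(2-) is_ideal_uminus [OF is_ideal_var_ideal] is_ideal_add [OF is_ideal_var_ideal]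
        is_ideal_diff [OF is_ideal_var_ideal] by metis
    then show "\<exists>u. u - f * b\<^sub>1 \<in> var_ideal V\<^sub>1 \<and> u - f * b\<^sub>2 \<in> var_ideal V\<^sub>2 \<and> u - f * b\<^sub>3 \<in> var_ideal V\<^sub>3"
      by blast
  qed
qed

section \<open>Regularity of single variables\<close>

lemma ps_linear_0 [simp]: "ps_linear 0 x y = ps_var y"
  by (simp add: ps_linear_def)

lemma regular_mod_var:
  assumes "complements J Y" "y \<notin> Y" "z - ps_var y \<in> J"
  shows "regular_mod J z"
  \<comment> \<open>With c = 0 any variable other than y can serve as x; \<open>Suc y\<close> is
    such a choice.\<close>
  using complements_regular [of J Y "Suc y" y 0 z] assms by simp

lemma regular_seq_mod_snoc:
  assumes "regular_seq_mod J zs" "complements (foldl adjoin J zs) Y" "y \<notin> Y"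
    and "w - ps_var y \<in> foldl adjoin J zs"
  shows "regular_seq_mod J (zs @ [w])"
  using assms(1) regular_mod_var [OF assms(2-4)] by (simp add: regular_seq_mod_append)

lemma regular_seq_mod_vars:
  assumes "distinct is" "inj_on y (set is)" "y ` set is \<inter> V = {}"
    and "\<And>i. i \<in> set is \<Longrightarrow> z i - ps_var (y i) \<in> var_ideal V"
  shows "regular_seq_mod (var_ideal V) (map z is)"
    and "complements (foldl adjoin (var_ideal V) (map z is)) (y ` set is \<union> V)"
  using complements_regular_seq [OF complements_var_ideal assms(1-3), of "\<lambda>i. Suc (y i)" 0 z] assms(4)
  by simp_all

section \<open>Depths of the two quotient rings\<close>

context
  fixes q m :: nat and Z V\<^sub>1 V\<^sub>2 V\<^sub>3 :: "nat set"
  assumes q: "3 \<le> q" "q < m"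
  defines "Z \<equiv> - {1..2 * m}"
  defines "V\<^sub>1 \<equiv> {1..m} \<union> Z" and "V\<^sub>2 \<equiv> {q..m + q - 1} \<union> Z" and "V\<^sub>3 \<equiv> {m + 1..2 * m} \<union> Z"
begin

text \<open>The bound q - 1 keeps the indices 1, ..., t out of F_2, and m - q + 1 keeps the shifted
  indices, which lie beyond F_1 and F_2, inside F_3. The last element reduces to a single fresh
  variable in each component: X_(m+1), X_1 and X_q respectively.\<close>

lemma regular_seq_three_ideals:
  fixes z :: "nat \<Rightarrow> ('k::field) ps" and w :: "'k ps"
  assumes t: "1 \<le> t" "t \<le> q - 1" "t \<le> m - q + 1"
  defines "z \<equiv> \<lambda>i. ps_var i + ps_var (m + q - 1 + i)"
  defines "w \<equiv> ps_var 1 + ps_var q + ps_var (m + 1)"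
  shows "regular_seq_mod (var_ideal V\<^sub>1 \<inter> (var_ideal V\<^sub>2 \<inter> var_ideal V\<^sub>3)) (map z [1..<Suc t] @ [w])"
proof -
  define js where "js = [1..<Suc t]"
  let ?d = "\<lambda>i. m + q - 1 + i"
  let ?J = "\<lambda>V. foldl adjoin (var_ideal V) (map z js)"
  have js: "distinct js" "set js = {1..t}"
    by (simp_all only: js_def distinct_upt set_upt atLeastLessThanSuc_atLeastAtMost)
  have J: "is_ideal (?J V)" "var_ideal V \<subseteq> ?J V" "set (map z js) \<subseteq> ?J V" for V
    by (rule is_ideal_foldl_adjoin foldl_adjoin_supset set_subset_foldl_adjoin is_ideal_var_ideal)+
  \<comment> \<open>If the ideal contains the X_i, then \<open>z i\<close> reduces to its shifted
    variable.\<close>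
  have d: "regular_seq_mod (var_ideal V) (map z js)"
      "complements (?J V) (?d ` set js \<union> V)"
    if V: "{1..t} \<subseteq> V" "?d ` {1..t} \<inter> V = {}" for V
  proof -
    have "z i - ps_var (?d i) \<in> var_ideal V" if "i \<in> set js" for i
      using that V(1) unfolding js(2) by (auto simp: z_def)
    moreover have "?d ` set js \<inter> V = {}" using V(2) by (simp only: js(2))
    ultimately show "regular_seq_mod (var_ideal V) (map z js)"
        "complements (?J V) (?d ` set js \<union> V)"
      using regular_seq_mod_vars [OF js(1), of ?d V z] by (simp_all add: inj_on_def)
  qed
  \<comment> \<open>If the ideal contains the shifted variables, then \<open>z i\<close> reduces to
    X_i.\<close>
  have a: "regular_seq_mod (var_ideal V) (map z js)"
      "complements (?J V) (set js \<union> V)"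
    if V: "?d ` {1..t} \<subseteq> V" "{1..t} \<inter> V = {}" for V
  proof -
    have "z i - ps_var i \<in> var_ideal V" if "i \<in> set js" for i
    proof -
      have "?d i \<in> V" using that V(1) unfolding js(2) by blast
      then show ?thesis by (simp add: z_def ps_var_in_var_ideal)
    qed
    moreover have "set js \<inter> V = {}" using V(2) by (simp only: js(2))
    ultimately show "regular_seq_mod (var_ideal V) (map z js)"
        "complements (?J V) (set js \<union> V)"
      using regular_seq_mod_vars [OF js(1), of "\<lambda>i. i" V z] by simp_all
  qed
  have d12: "?d ` {1..t} \<inter> (V\<^sub>1 \<union> V\<^sub>2) = {}" and a12: "{1..t} \<subseteq> V\<^sub>1"
    and a23: "{1..t} \<inter> (V\<^sub>2 \<union> V\<^sub>3) = {}" and d23: "?d ` {1..t} \<subseteq> V\<^sub>3"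
    using q t by (auto simp: V\<^sub>1_def V\<^sub>2_def V\<^sub>3_def Z_def)
  have seq1: "regular_seq_mod (var_ideal V\<^sub>1) (map z js @ [w])"
  proof -
    have "m + 1 \<notin> ?d ` set js \<union> V\<^sub>1" using q by (auto simp: V\<^sub>1_def Z_def)
    moreover have "w - ps_var (m + 1) \<in> var_ideal V\<^sub>1"
      unfolding w_def using q by (auto simp: V\<^sub>1_def intro!: is_ideal_add [OF is_ideal_var_ideal])
    moreover from this have "w - ps_var (m + 1) \<in> ?J V\<^sub>1" using J(2) by blast
    moreover have "?d ` {1..t} \<inter> V\<^sub>1 = {}" using d12 by blast
    ultimately show ?thesis
      by (intro regular_seq_mod_snoc [OF d [OF a12], where y = "m + 1"])
  qed
  have seq3: "regular_seq_mod (var_ideal V\<^sub>3) (map z js @ [w])"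
  proof -
    have q': "q \<notin> set js \<union> V\<^sub>3" using q t by (auto simp: js V\<^sub>3_def Z_def)
    have "ps_var (m + q - 1 + 1) \<in> var_ideal V\<^sub>3" "ps_var (m + 1) \<in> var_ideal V\<^sub>3"
      using q by (auto simp: V\<^sub>3_def)
    then have "ps_var (m + q - 1 + 1) \<in> ?J V\<^sub>3" "ps_var (m + 1) \<in> ?J V\<^sub>3"
      using J(2) by blast+
    moreover have "z 1 \<in> ?J V\<^sub>3" using J(3) [of V\<^sub>3] t by (auto simp: js)
    \<comment> \<open>Since X_(m+q) lies in P_3, \<open>z 1\<close> puts X_1 into the ideal, and X_q
      is what remains of \<open>w\<close>.\<close>
    ultimately have "z 1 - ps_var (m + q - 1 + 1) + ps_var (m + 1) \<in> ?J V\<^sub>3"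
      using J(1) [of V\<^sub>3] by (intro is_ideal_add is_ideal_diff)
    then have "w - ps_var q \<in> ?J V\<^sub>3" by (simp add: w_def z_def)
    moreover have "{1..t} \<inter> V\<^sub>3 = {}" using a23 by blast
    ultimately show ?thesis
      using q' by (intro regular_seq_mod_snoc [OF a [OF d23], where y = q])
  qed
  have seq2: "regular_seq_mod (var_ideal V\<^sub>2) (map z js @ [w])"
  proof -
    \<comment> \<open>Modulo P_2 both variables of \<open>z i\<close> survive, so c = 1; the shifted
      one is eliminated and X_1 stays available for \<open>w\<close>.\<close>
    have cond: "i \<noteq> ?d i \<and> (1 = (0 :: 'k) \<or> i \<notin> V\<^sub>2 \<union> ?d ` set js) \<and>
        z i - ps_linear 1 i (?d i) \<in> var_ideal V\<^sub>2" if "i \<in> set js" for i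
    proof -
      have i: "1 \<le> i" "i \<le> t" using that by (simp_all add: js)
      then have "i \<notin> V\<^sub>2" using a23 by auto
      moreover have "i \<notin> ?d ` set js" using i q t by (auto simp: js)
      moreover have "z i - ps_linear 1 i (?d i) = 0" by (simp add: z_def ps_linear_def)
      ultimately show ?thesis using q i by (simp add: is_ideal_zero [OF is_ideal_var_ideal])
    qed
    have inj: "inj_on ?d (set js)" by (simp add: inj_on_def)
    have disj: "?d ` set js \<inter> V\<^sub>2 = {}" using d12 unfolding js by blast
    note rule = complements_regular_seq [OF complements_var_ideal js(1) inj disj cond]
    have "regular_seq_mod (var_ideal V\<^sub>2) (map z js)" by (rule rule(1))
    moreover have "complements (?J V\<^sub>2) (?d ` set js \<union> V\<^sub>2)" by (rule rule(2))
    moreover have "1 \<notin> ?d ` set js \<union> V\<^sub>2" using q by (auto simp: V\<^sub>2_def Z_def)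
    moreover have "w - ps_var 1 \<in> var_ideal V\<^sub>2"
      unfolding w_def using q by (auto simp: V\<^sub>2_def intro!: is_ideal_add [OF is_ideal_var_ideal])
    moreover from this have "w - ps_var 1 \<in> ?J V\<^sub>2" using J(2) by blast
    ultimately show ?thesis by (intro regular_seq_mod_snoc [where y = 1])
  qed
  \<comment> \<open>Gluing starts with P_2 and P_3. Adding P_1 afterwards involves P_1 + (P_2
    \<inter> P_3), which is the variable ideal P_1 + P_2.\<close>
  have "regular_seq_mod (ideal_sum (var_ideal V\<^sub>2) (var_ideal V\<^sub>3)) (map z js)"
    unfolding ideal_sum_var_ideal using a23 d23 by (intro a) auto
  then have seq23: "regular_seq_mod (var_ideal V\<^sub>2 \<inter> var_ideal V\<^sub>3) (map z js @ [w])"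
    using seq2 seq3 by (intro regular_seq_mod_Int is_ideal_var_ideal)
  have "V\<^sub>2 - V\<^sub>1 \<subseteq> V\<^sub>3" using q by (auto simp: V\<^sub>1_def V\<^sub>2_def V\<^sub>3_def)
  then have "regular_seq_mod (ideal_sum (var_ideal V\<^sub>1) (var_ideal V\<^sub>2 \<inter> var_ideal V\<^sub>3)) (map z js)"
    using d12 a12 by (simp only: ideal_sum_var_ideal_Int) (intro d, auto)
  then show ?thesis
    unfolding js_def [symmetric]
    by (rule regular_seq_mod_Int [OF is_ideal_var_ideal
          is_ideal_Int [OF is_ideal_var_ideal is_ideal_var_ideal] _ seq1 seq23])
qed

lemma depth_three_ideals:
  fixes h :: "('k::field) ps \<Rightarrow> 'r"
  assumes "ps_quotient R h" "ps_quotient.ker R h = var_ideal V\<^sub>1 \<inter> (var_ideal V\<^sub>2 \<inter> var_ideal V\<^sub>3)"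
  shows "depth R = enat (min (m - q + 1) (q - 1) + 1)"
proof -
  interpret ps_quotient R h by fact
  note ker = assms(2)
  have out: "var_ideal (- {1..2 * m}) \<subseteq> ker"
    unfolding ker V\<^sub>1_def V\<^sub>2_def V\<^sub>3_def Z_def by (intro Int_greatest var_ideal_mono) auto
  have prod: "ps_var i * ps_var j \<in> ker"
    if "(i \<in> V\<^sub>1 \<or> j \<in> V\<^sub>1) \<and> (i \<in> V\<^sub>2 \<or> j \<in> V\<^sub>2) \<and> (i \<in> V\<^sub>3 \<or> j \<in> V\<^sub>3)" for i j
    unfolding ker using that by (simp add: ps_var_mult_in_var_ideal)
  have lin: "ps_coeff f {#i#} = 0" if "f \<in> ker" "i \<notin> V\<^sub>1 \<or> i \<notin> V\<^sub>3" for f i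
    using that unfolding ker by (auto simp: var_ideal_def)
  define t where "t = min (m - q + 1) (q - 1)"
  define z :: "nat \<Rightarrow> 'k ps" where "z = (\<lambda>i. ps_var i + ps_var (m + q - 1 + i))"
  define w :: "'k ps" where "w = ps_var 1 + ps_var q + ps_var (m + 1)"
  have "depth R = enat (t + 1)"
  proof (rule depth_eqI)
    show "set (map z [1..<Suc t] @ [w]) \<subseteq> ps_maximal"
      by (auto simp: z_def w_def var_def)
    have "1 \<le> t" "t \<le> q - 1" "t \<le> m - q + 1" using q by (auto simp: t_def)
    then show "regular_seq_mod ker (map z [1..<Suc t] @ [w])"
      unfolding ker z_def w_def by (rule regular_seq_three_ideals)
    fix zs :: "'k ps list" assume zs: "set zs \<subseteq> ps_maximal" "regular_seq_mod ker zs"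
    \<comment> \<open>U is F_1 and V is the intersection of F_2 and F_3, so each product lies in all
      three ideals. The bound is m - q + 2.\<close>
    have "length zs + card ({1..m} \<union> {m + 1..m + q - 1}) \<le> Suc (card {1..2 * m})"
      by (rule regular_seq_length_le [OF out _ _ _ _ _ _ lin lin zs, of _ _ 1 "m + 1"])
         (use q in \<open>auto intro!: prod simp: V\<^sub>1_def V\<^sub>2_def V\<^sub>3_def Z_def\<close>)
    \<comment> \<open>U is F_3 and V is the intersection of F_1 and F_2, with bound q.\<close>
    moreover have "length zs + card ({m + 1..2 * m} \<union> {q..m}) \<le> Suc (card {1..2 * m})"
      by (rule regular_seq_length_le [OF out _ _ _ _ _ _ lin lin zs, of _ _ "m + 1" q])
         (use q in \<open>auto intro!: prod simp: V\<^sub>1_def V\<^sub>2_def V\<^sub>3_def Z_def\<close>)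
    moreover have "{1..m} \<union> {m + 1..m + q - 1} = {1..m + q - 1}" "{m + 1..2 * m} \<union> {q..m} = {q..2 * m}"
      using q by auto
    ultimately show "length zs \<le> t + 1" using q by (auto simp: t_def)
  qed simp
  then show ?thesis by (simp add: t_def)
qed

text \<open>X_1 + X_(2m) is regular, as it reduces to X_(2m) modulo P_1 + P_2 and to X_1 modulo P_2
  + P_3. For the upper bound F_1 and F_3 exhaust all variables, and their products lie in both
  ideals.\<close>

lemma depth_conductor_quotient:
  fixes h :: "('k::field) ps \<Rightarrow> 'r"
  assumes "ps_quotient R h" "ps_quotient.ker R h = var_ideal (V\<^sub>1 \<union> V\<^sub>2) \<inter> var_ideal (V\<^sub>2 \<union> V\<^sub>3)"
  shows "depth R = 1"
proof -
  interpret ps_quotient R h by fact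
  note ker = assms(2)
  let ?w = "ps_var 1 + ps_var (2 * m) :: 'k ps"
  have "depth R = enat 1"
  proof (rule depth_eqI)
    show "set [?w] \<subseteq> ps_maximal" by (simp add: var_def)
    have "?w - ps_var (2 * m) \<in> var_ideal (V\<^sub>1 \<union> V\<^sub>2)" "?w - ps_var 1 \<in> var_ideal (V\<^sub>2 \<union> V\<^sub>3)"
      using q by (auto simp: V\<^sub>1_def V\<^sub>3_def)
    moreover have "2 * m \<notin> V\<^sub>1 \<union> V\<^sub>2" "1 \<notin> V\<^sub>2 \<union> V\<^sub>3"
      using q by (auto simp: V\<^sub>1_def V\<^sub>2_def V\<^sub>3_def Z_def)
    ultimately have "regular_mod ker ?w"
      unfolding ker by (intro regular_mod_Int regular_mod_var [OF complements_var_ideal])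
    then show "regular_seq_mod ker [?w]" by simp
    fix zs :: "'k ps list" assume zs: "set zs \<subseteq> ps_maximal" "regular_seq_mod ker zs"
    have "length zs + card ({1..m} \<union> {m + 1..2 * m}) \<le> Suc (card {1..2 * m})"
    proof (rule regular_seq_length_le [OF _ _ _ _ _ _ _ _ _ zs, of _ _ _ 1 "2 * m"])
      show "var_ideal (- {1..2 * m}) \<subseteq> ker"
        unfolding ker V\<^sub>1_def V\<^sub>2_def V\<^sub>3_def Z_def by (intro Int_greatest var_ideal_mono) auto
      show "ps_var i * ps_var j \<in> ker" if "i \<in> {1..m}" "j \<in> {m + 1..2 * m}" for i j
        unfolding ker using that
        by (intro IntI ps_var_mult_in_var_ideal) (auto simp: V\<^sub>1_def V\<^sub>3_def)
      show "ps_coeff f {#1#} = 0" if "f \<in> ker" for f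
        using that q unfolding ker by (auto simp: var_ideal_def V\<^sub>2_def V\<^sub>3_def Z_def)
      show "ps_coeff f {#2 * m#} = 0" if "f \<in> ker" for f
        using that q unfolding ker by (auto simp: var_ideal_def V\<^sub>1_def V\<^sub>2_def Z_def)
    qed (use q in auto)
    moreover have "{1..m} \<union> {m + 1..2 * m} = {1..2 * m}" using q by auto
    ultimately show "length zs \<le> 1" by simp
  qed simp
  then show ?thesis by (simp add: one_enat_def)
qed

end

section \<open>The conductor and the proof of the theorem\<close>

lemma RDirProd_mult:
  "(a, b) \<otimes>\<^bsub>RDirProd R S\<^esub> (c, d) = (a \<otimes>\<^bsub>R\<^esub> c, b \<otimes>\<^bsub>S\<^esub> d)"
  by (simp add: RDirProd_def DirProd_def monoid.defs)

text \<open>\<open>C\<close> is the image of \<open>L\<close>, hence an ideal, and it is proper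
  because \<open>L\<close> is. So the conductor need only be known through its preimage.\<close>

lemma image_conductor:
  fixes h :: "('k::field) ps \<Rightarrow> 'r"
  assumes "ps_quotient R h" "is_ideal L" "ps_quotient.ker R h \<subseteq> L"
    and C: "\<And>f. h f \<in> C \<longleftrightarrow> f \<in> L" "C \<subseteq> carrier R" "L \<noteq> UNIV"
  shows "ps_quotient (R Quot C) (\<lambda>f. C +>\<^bsub>R\<^esub> h f)"
    and "ps_quotient.ker (R Quot C) (\<lambda>f. C +>\<^bsub>R\<^esub> h f) = L"
proof -
  interpret ps_quotient R h by fact
  have "C = h ` L"
  proof (intro equalityI subsetI)
    fix x assume "x \<in> C"
    then obtain f where "x = h f" using C(2) surj by blast
    then show "x \<in> h ` L" using \<open>x \<in> C\<close> C(1) by simp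
  next
    fix x assume "x \<in> h ` L"
    then show "x \<in> C" using C(1) by auto
  qed
  then have ideal: "ideal C R" using ideal_image [OF assms(2)] by simp
  obtain f where "f \<notin> L" using C(3) by blast
  then have "h f \<notin> C" using C(1) by simp
  then have proper: "C \<noteq> carrier R" using hom_closed by metis
  show "ps_quotient (R Quot C) (\<lambda>f. C +>\<^bsub>R\<^esub> h f)" by (rule quotient(1) [OF ideal proper])
  show "ps_quotient.ker (R Quot C) (\<lambda>f. C +>\<^bsub>R\<^esub> h f) = L"
    using quotient(2) [OF ideal proper] by (simp only: C(1) Collect_mem_eq)
qed

theorem proposition5p8:
  fixes q m n :: nat
    and T :: "('k::field) series ring"
  assumes "3 \<le> q" and "q < m"
  defines "n \<equiv> 2 * m"
  defines "T \<equiv> power_series_ring n"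
  defines "F\<^sub>1 \<equiv> var ` {1..m}"
    and "F\<^sub>2 \<equiv> var ` {q..m + q - 1}"
    and "F\<^sub>3 \<equiv> var ` {m + 1..n}"
  defines "P\<^sub>1 \<equiv> Idl\<^bsub>T\<^esub> F\<^sub>1"
    and "P\<^sub>2 \<equiv> Idl\<^bsub>T\<^esub> F\<^sub>2"
    and "P\<^sub>3 \<equiv> Idl\<^bsub>T\<^esub> F\<^sub>3"
  defines "A \<equiv> T Quot (P\<^sub>1 \<inter> P\<^sub>2 \<inter> P\<^sub>3)"
    and "B \<equiv> RDirProd (T Quot P\<^sub>1) (RDirProd (T Quot P\<^sub>2) (T Quot P\<^sub>3))"
  defines "I \<equiv> conductor A (diagonal T P\<^sub>1 P\<^sub>2 P\<^sub>3) B"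
  shows "depth A = enat (min (m - q + 1) (q - 1) + 1)
    \<and> min (m - q + 1) (q - 1) + 1 \<ge> 3
    \<and> depth (A Quot I) = 1"
proof (intro conjI)
  define Z where "Z = - {1..2 * m}"
  define V\<^sub>1 where "V\<^sub>1 = {1..m} \<union> Z"
  define V\<^sub>2 where "V\<^sub>2 = {q..m + q - 1} \<union> Z"
  define V\<^sub>3 where "V\<^sub>3 = {m + 1..2 * m} \<union> Z"
  note V_defs = V\<^sub>1_def V\<^sub>2_def V\<^sub>3_def Z_def
  let ?h = "series_of n :: 'k ps \<Rightarrow> 'k series"
  let ?P = "P\<^sub>1 \<inter> P\<^sub>2 \<inter> P\<^sub>3"
  interpret T: ps_quotient T ?h unfolding T_def by (rule ps_quotient_series_of)
  \<comment> \<open>From here on the P_i are handled through their preimages, which also contain the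
    variables outside {1..n}.\<close>
  have mem: "?h f \<in> P\<^sub>1 \<longleftrightarrow> f \<in> var_ideal V\<^sub>1" "?h f \<in> P\<^sub>2 \<longleftrightarrow> f \<in> var_ideal V\<^sub>2"
    "?h f \<in> P\<^sub>3 \<longleftrightarrow> f \<in> var_ideal V\<^sub>3" for f
    unfolding P\<^sub>1_def P\<^sub>2_def P\<^sub>3_def F\<^sub>1_def F\<^sub>2_def F\<^sub>3_def T_def n_def V_defs
    using assms(1,2) by (intro series_of_mem_genideal_iff; auto)+
  have F: "F\<^sub>1 \<subseteq> carrier T" "F\<^sub>2 \<subseteq> carrier T" "F\<^sub>3 \<subseteq> carrier T"
    unfolding F\<^sub>1_def F\<^sub>2_def F\<^sub>3_def T_def n_def using assms(1,2)
    by (auto intro!: var_in_carrier)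
  have ideals: "ideal P\<^sub>1 T" "ideal P\<^sub>2 T" "ideal P\<^sub>3 T"
    unfolding P\<^sub>1_def P\<^sub>2_def P\<^sub>3_def using F by (auto intro: T.genideal_ideal)
  then have P: "ideal ?P T" by (intro T.i_intersect)
  have one: "1 \<notin> (var_ideal V :: 'k ps set)" for V
    using var_ideal_subset_maximal [of V] by (auto simp: ps_coeff_one)
  have "?h 1 \<notin> P\<^sub>1" "?h 1 \<notin> P\<^sub>2" "?h 1 \<notin> P\<^sub>3" "?h 1 \<notin> ?P" by (simp_all add: mem one)
  moreover have "?h 1 \<in> carrier T" by (rule T.hom_closed)
  ultimately have proper: "P\<^sub>1 \<noteq> carrier T" "P\<^sub>2 \<noteq> carrier T" "P\<^sub>3 \<noteq> carrier T" "?P \<noteq> carrier T"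
    by blast+
  let ?a = "\<lambda>f. ?P +>\<^bsub>T\<^esub> ?h f"
  have A: "ps_quotient A ?a"
    and kerA: "ps_quotient.ker A ?a = var_ideal V\<^sub>1 \<inter> (var_ideal V\<^sub>2 \<inter> var_ideal V\<^sub>3)"
    unfolding A_def using T.quotient [OF P proper(4)] by (auto simp: mem)
  interpret A: ps_quotient A ?a by (rule A)
  interpret B1: ps_quotient "T Quot P\<^sub>1" "\<lambda>f. P\<^sub>1 +>\<^bsub>T\<^esub> ?h f" by (rule T.quotient [OF ideals(1) proper(1)])
  interpret B2: ps_quotient "T Quot P\<^sub>2" "\<lambda>f. P\<^sub>2 +>\<^bsub>T\<^esub> ?h f" by (rule T.quotient [OF ideals(2) proper(2)])
  interpret B3: ps_quotient "T Quot P\<^sub>3" "\<lambda>f. P\<^sub>3 +>\<^bsub>T\<^esub> ?h f" by (rule T.quotient [OF ideals(3) proper(3)])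
  have kerB: "B1.ker = var_ideal V\<^sub>1" "B2.ker = var_ideal V\<^sub>2" "B3.ker = var_ideal V\<^sub>3"
    using T.quotient(2) [OF ideals(1) proper(1)] T.quotient(2) [OF ideals(2) proper(2)]
      T.quotient(2) [OF ideals(3) proper(3)]
    by (simp_all only: mem Collect_mem_eq)

  show "depth A = enat (min (m - q + 1) (q - 1) + 1)"
    by (rule depth_three_ideals [OF assms(1,2) A kerA [unfolded V_defs]])
  show "3 \<le> min (m - q + 1) (q - 1) + 1" using assms(1,2) by simp arith

  let ?b = "\<lambda>f. (P\<^sub>1 +>\<^bsub>T\<^esub> ?h f, P\<^sub>2 +>\<^bsub>T\<^esub> ?h f, P\<^sub>3 +>\<^bsub>T\<^esub> ?h f)"
  let ?L = "var_ideal (V\<^sub>1 \<union> V\<^sub>2) \<inter> var_ideal (V\<^sub>2 \<union> V\<^sub>3) :: 'k ps set"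
  have diag: "diagonal T P\<^sub>1 P\<^sub>2 P\<^sub>3 (?a f) = ?b f" for f
    using ideals P by (intro diagonal_coset) auto
  have carrierB: "(\<forall>b\<in>carrier B. Q b) \<longleftrightarrow>
      (\<forall>b\<^sub>1 b\<^sub>2 b\<^sub>3. Q (P\<^sub>1 +>\<^bsub>T\<^esub> ?h b\<^sub>1, P\<^sub>2 +>\<^bsub>T\<^esub> ?h b\<^sub>2, P\<^sub>3 +>\<^bsub>T\<^esub> ?h b\<^sub>3))" for Q
    unfolding B_def RDirProd_carrier B1.surj [symmetric] B2.surj [symmetric] B3.surj [symmetric]
    by simp
  have mult: "?b f \<otimes>\<^bsub>B\<^esub> (P\<^sub>1 +>\<^bsub>T\<^esub> ?h b\<^sub>1, P\<^sub>2 +>\<^bsub>T\<^esub> ?h b\<^sub>2, P\<^sub>3 +>\<^bsub>T\<^esub> ?h b\<^sub>3) =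
      (P\<^sub>1 +>\<^bsub>T\<^esub> ?h (f * b\<^sub>1), P\<^sub>2 +>\<^bsub>T\<^esub> ?h (f * b\<^sub>2), P\<^sub>3 +>\<^bsub>T\<^esub> ?h (f * b\<^sub>3))" for f b\<^sub>1 b\<^sub>2 b\<^sub>3
    by (simp only: B_def RDirProd_mult B1.hom_mult B2.hom_mult B3.hom_mult)
  have image: "diagonal T P\<^sub>1 P\<^sub>2 P\<^sub>3 ` carrier A = range ?b"
    by (simp only: A.surj [symmetric] image_image diag)
  have range: "x \<in> range ?b \<longleftrightarrow> (\<exists>u. ?b u = x)" for x
    by (simp only: image_iff bex_UNIV eq_commute [of x])
  \<comment> \<open>On representatives the conductor condition asks that every triple (f b_1, f b_2,
    f b_3) lift to a single series, which \<open>conductor_var_ideal_iff\<close>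
    characterises.\<close>
  have C: "?a f \<in> I \<longleftrightarrow> f \<in> ?L" for f
  proof -
    have "?a f \<in> I \<longleftrightarrow> (\<forall>b\<^sub>1 b\<^sub>2 b\<^sub>3. \<exists>u. ?b u =
        (P\<^sub>1 +>\<^bsub>T\<^esub> ?h (f * b\<^sub>1), P\<^sub>2 +>\<^bsub>T\<^esub> ?h (f * b\<^sub>2), P\<^sub>3 +>\<^bsub>T\<^esub> ?h (f * b\<^sub>3)))"
    proof -
      have "?a f \<in> I \<longleftrightarrow> (\<forall>b\<in>carrier B. ?b f \<otimes>\<^bsub>B\<^esub> b \<in> range ?b)"
        unfolding I_def conductor_def image by (simp add: diag)
      also have "\<dots> \<longleftrightarrow> (\<forall>b\<^sub>1 b\<^sub>2 b\<^sub>3.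
          (P\<^sub>1 +>\<^bsub>T\<^esub> ?h (f * b\<^sub>1), P\<^sub>2 +>\<^bsub>T\<^esub> ?h (f * b\<^sub>2), P\<^sub>3 +>\<^bsub>T\<^esub> ?h (f * b\<^sub>3)) \<in> range ?b)"
        by (simp only: carrierB mult)
      finally show ?thesis by (simp only: range)
    qed
    also have "\<dots> \<longleftrightarrow> f \<in> ?L"
      unfolding prod.inject B1.hom_eq_iff B2.hom_eq_iff B3.hom_eq_iff kerB
      using assms(1,2) by (intro conductor_var_ideal_iff) (auto simp: V_defs)
    finally show ?thesis .
  qed
  have L: "is_ideal ?L" by (intro is_ideal_Int is_ideal_var_ideal)
  have "A.ker \<subseteq> ?L" unfolding kerA by (auto simp: var_ideal_def)
  note quotient = image_conductor [OF A L this C]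
  have "I \<subseteq> carrier A" by (auto simp: I_def conductor_def)
  note quotient = quotient [OF this]
  have "?L \<noteq> UNIV" using one by blast
  note quotient = quotient [OF this]
  show "depth (A Quot I) = 1"
    by (rule depth_conductor_quotient [OF assms(1,2) quotient(1) quotient(2) [unfolded V_defs]])
qed

end
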